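(* Assume the standing conditions on $F$ and $\sigma$, the eventual strict monotonicity of $F$ (with constants $R, C_4^F>0$), and the finite support condition (with constant $C>0$ and random variables $b_1,\dots,b_p$), all as written out in the context. Let $A_1:=\overline{B(0,R+C)}\subset\mathbb{R}^d$ and suppose that $$\pi(A_1)<\frac{C_4^F}{C_3^F+C_4^F}.$$ Then for every $\eta>0$, $$\mathbf{P}\big(\mathcal{R}(\omega^-)<\eta\big)=1.$$ Consequently weak synchronization holds for the SDE, i.e. there exists a random point $b:\tilde{\mathcal{B}}\to\mathbb{R}^d$ such that $\mathrm{supp}(\mu_{\omega^-})=\{b(\omega^-)\}$ for $\mathbf{P}$-almost every $\omega^-\in\tilde{\mathcal{B}}$.
   Context: **Noise.** Fix $d\ge1$, $H\in(0,1)$. For $h\in(0,1)$ let $\mathcal{B}_h$ be the closure of $C_0^\infty(\mathbb{R}^-,\mathbb{R}^d)$ (smooth compactly supported $\omega:\mathbb{R}^-=(-\infty,0]\to\mathbb{R}^d$ with $\omega(0)=0$) under $\|\omega\|_{\mathcal{B}_h}:=\sup_{s,t\in\mathbb{R}^-}\frac{|\omega(t)-\omega(s)|}{\sqrt{1+|t|+|s|}\,|t-s|^{(1-h)/2}}$ (a separable Banach space), and write $\mathcal{B}:=\mathcal{B}_H$. $\mathbf{P}$ is the Gaussian measure on $\mathcal{B}$ under which the canonical process is a time-reversed Brownian motion. $\mathcal{D}_H:\mathcal{B}_H\to\mathcal{B}_{1-H}$ is the continuous extension of $\mathcal{D}_H\omega(t)=\frac1{\alpha_H}\int_{-\infty}^0(-r)^{H-1/2}(\dot\omega(t+r)-\dot\omega(r))\,dr$,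 where $\alpha_H$ is the normalizing constant for which the canonical process under $(\mathcal{D}_H)_*\mathbf{P}$ is a time-reversed fractional Brownian motion with Hurst parameter $H$. For $t\ge0$ put $\vartheta_t\omega(s):=\omega(s-t)-\omega(-t)$ ($s\le0$) and $P_t(\omega^-,\omega^+)(s):=\omega^+(-s-t)-\omega^+(-t)$ for $-t\le s\le0$, $:=\omega^-(s+t)-\omega^+(-t)$ for $s\le-t$. Let $\Omega:=\mathcal{B}\times\mathcal{B}$, $\mathbb{P}:=\mathbf{P}\times\mathbf{P}$, $\theta_t(\omega^-,\omega^+):=(P_t(\omega^-,\omega^+),\vartheta_t\omega^+)$ for $t\ge0$ and $\theta_t(\omega^-,\omega^+):=(\vartheta_{-t}\omega^-,P_{-t}(\omega^+,\omega^-))$ for $t<0$. Then $B^H_t(\omega):=-(\mathcal{D}_HP_t(\omega^-,\omega^+))(-t)$, $t\ge0$, is a fractional Brownian motion under $\mathbb{P}$. **SDE and standing conditions.** Consider $dY_t=F(Y_t)\,dt+\sigma\,dB^H_t$, $Y_0=x\in\mathbb{R}^d$, with: (1) $\sigma$ an invertible $d\times d$ matrix; (2) for some $C_1^F,C_2^F,C_3^F>0$ and all $\xi_1,\xi_2\in\mathbb{R}^d$, $\langle F(\xi_2)-F(\xi_1),\xi_2-\xi_1\rangle\le\min\{C_1^F-C_2^F|\xi_2-\xi_1|^2,\;C_3^F|\xi_2-\xi_1|^2\}$; (3) $F$ is differentiable and for some $C_F>0$, $N\ge1$: $|F(\xi)|\le C_F(1+|\xi|)^N$ and $|D_\xi F|\le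 C_F(1+|\xi|)^N$ for all $\xi$; (4) if $H>1/2$, the derivative of $F$ is globally bounded. Let $\Phi^t_\omega(x)$ be the solution: $\Phi^t_\omega(x)=x+\int_0^tF(\Phi^s_\omega(x))\,ds+\sigma B^H_t(\omega)$. Set $\varphi^t_{\omega^-}(x):=\Phi^t_{\theta_{-t}(\omega^-,\omega^+)}(x)$, which depends only on $\omega^-$; then $\Phi^t_{(\omega^-,\omega^+)}(x)=\varphi^t_{P_t(\omega^-,\omega^+)}(x)$. **Invariant measure.** $\mu$ is the (known to exist and be) unique probability measure on $\mathbb{R}^d\times\mathcal{B}$ with $\mathcal{B}$-marginal $\mathbf{P}$ that is invariant under the Feller transition semigroup $\mathcal{Q}_t((x,\omega^-);\Gamma):=\int_{\mathcal{B}}\chi_\Gamma\big(\varphi^t_{P_t(\omega^-,\omega^+)}(x),P_t(\omega^-,\omega^+)\big)\mathbf{P}(d\omega^+)$. $\pi$ denotes the marginal of $\mu$ on $\mathbb{R}^d$. **Disintegration.** Fix a measurable $\tilde{\mathcal{B}}\subseteq\mathcal{B}$ with $\mathbf{P}(\tilde{\mathcal{B}})=1$ and probability measures $\{\mu_{\omega^-}\}$ on $\mathbb{R}^d$ (known to exist) such that $\omega^-\mapsto\mu_{\omega^-}(A)$ is measurable and $\mu(A\times D)=\int_D\mu_{\omega^-}(A)\,\mathbf{P}(d\omega^-)$ for Borel $A,D$, and such that for all $(\omega^-,\omega^+)\in\tilde{\mathcal{B}}\times\mathcal{B}$, $t\ge0$: $P_t(\omega^-,\omega^+)\in\tilde{\mathcal{B}}$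 and $(\Phi^t_{(\omega^-,\omega^+)})_*\mu_{\omega^-}=\mu_{P_t(\omega^-,\omega^+)}$. **Eventual strict monotonicity.** There are $R>0$, $C_4^F>0$ with $\langle F(x)-F(y),x-y\rangle\le-C_4^F|x-y|^2$ whenever $|x|,|y|\ge R$. **Finite support condition.** There are $p\in\mathbb{N}$ and random variables $b_i:\tilde{\mathcal{B}}\to\mathbb{R}^d$, $1\le i\le p$, with $\mathrm{supp}(\mu_{\omega^-})=\{b_i(\omega^-):1\le i\le p\}$ for every $\omega^-\in\tilde{\mathcal{B}}$, and a deterministic $C>0$ such that, with $\tilde\Omega:=\tilde{\mathcal{B}}\times\mathcal{B}$ (of full measure), every $(\omega^-,\omega^+)\in\tilde\Omega$ satisfies $\mathcal{R}(\omega^-):=\max_{1\le i\ne j\le p}|b_i(\omega^-)-b_j(\omega^-)|\le C$ (with $\mathcal{R}=0$ if $p=1$), and $\theta_t(\tilde\Omega)\subseteq\tilde\Omega$ for all $t\ge0$. *)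

theory Defs
  imports "HOL-Probability.Probability"
begin

text \<open>
  A path on \<open>(-\<infinity>, 0]\<close> is represented by the function on \<open>real\<close> that extends it by \<open>0\<close> to the
  positive half-line, so that every path has exactly one representative.
\<close>

type_synonym 'n path = "real \<Rightarrow> real ^ 'n"

text \<open>The quotient for \<open>s = t\<close> is \<open>0 / 0 = 0\<close> and does not affect the supremum.\<close>

definition holder_norm :: "real \<Rightarrow> ('n::finite) path \<Rightarrow> ereal" where
  "holder_norm h w = (SUP s\<in>{..0}. SUP t\<in>{..0}.
     ereal (norm (w t - w s) / (sqrt (1 + \<bar>t\<bar> + \<bar>s\<bar>) * \<bar>t - s\<bar> powr ((1 - h) / 2))))"

text \<open>Derivatives at \<open>0\<close> are one-sided, and the support may contain \<open>0\<close>.\<close>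

definition smooth_paths :: "('n::finite) path set" where
  "smooth_paths = {w. (\<forall>t>0. w t = 0) \<and> w 0 = 0 \<and> bounded {t. w t \<noteq> 0} \<and>
     (\<exists>D. (\<forall>t\<le>0. D 0 t = w t) \<and>
          (\<forall>k::nat. \<forall>t\<le>0. (D k has_vector_derivative D (Suc k) t) (at t within {..0})))}"

definition path_space :: "real \<Rightarrow> ('n::finite) path set" where
  "path_space h = {w. (\<forall>t>0. w t = 0) \<and> w 0 = 0 \<and>
     (\<forall>e>0. \<exists>f\<in>smooth_paths. holder_norm h (\<lambda>t. w t - f t) < ereal e)}"

definition path_dist :: "real \<Rightarrow> ('n::finite) path \<Rightarrow> 'n path \<Rightarrow> real" where
  "path_dist h v w = real_of_ereal (holder_norm h (\<lambda>t. v t - w t))"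

definition path_topology :: "real \<Rightarrow> ('n::finite) path topology" where
  "path_topology h = Metric_space.mtopology (path_space h) (path_dist h)"

definition path_borel :: "real \<Rightarrow> ('n::finite) path measure" where
  "path_borel h = sigma (path_space h) {U. openin (path_topology h) U}"

text \<open>The increment over \<open>[s, t]\<close> has law \<open>N(0, (t - s) I)\<close>, given here by its density.\<close>

definition brownian_motion :: "'a measure \<Rightarrow> (real \<Rightarrow> 'a \<Rightarrow> real ^ ('n::finite)) \<Rightarrow> bool" where
  "brownian_motion M X \<longleftrightarrow>
     (\<forall>t\<ge>0. X t \<in> borel_measurable M) \<and>
     (AE w in M. X 0 w = 0) \<and>
     (AE w in M. continuous_on {0..} (\<lambda>t. X t w)) \<and>
     (\<forall>s t. 0 \<le> s \<and> s < t \<longrightarrow>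
        distributed M lborel (\<lambda>w. X t w - X s w)
          (\<lambda>x. ennreal (\<Prod>i\<in>UNIV. normal_density 0 (sqrt (t - s)) (x $ i)))) \<and>
     (\<forall>(n::nat) \<tau>. 0 \<le> \<tau> 0 \<and> (\<forall>k<n. \<tau> k < \<tau> (Suc k)) \<longrightarrow>
        prob_space.indep_vars M (\<lambda>_. borel) (\<lambda>k w. X (\<tau> (Suc k)) w - X (\<tau> k) w) {..<n})"

text \<open>Gaussian random variables may be degenerate, i.e. almost surely constant.\<close>

definition gaussian_var :: "'a measure \<Rightarrow> ('a \<Rightarrow> real) \<Rightarrow> bool" where
  "gaussian_var M Y \<longleftrightarrow> Y \<in> borel_measurable M \<and>
     ((\<exists>m s. s > 0 \<and> distributed M lborel Y (\<lambda>x. ennreal (normal_density m s x))) \<or>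
      (\<exists>m. AE w in M. Y w = m))"

definition fractional_brownian_motion ::
    "real \<Rightarrow> 'a measure \<Rightarrow> (real \<Rightarrow> 'a \<Rightarrow> real ^ ('n::finite)) \<Rightarrow> bool" where
  "fractional_brownian_motion H M X \<longleftrightarrow>
     (\<forall>t\<ge>0. X t \<in> borel_measurable M) \<and>
     (AE w in M. continuous_on {0..} (\<lambda>t. X t w)) \<and>
     (\<forall>T u. finite T \<and> T \<subseteq> {0..} \<longrightarrow> gaussian_var M (\<lambda>w. \<Sum>t\<in>T. u t \<bullet> X t w)) \<and>
     (\<forall>t\<ge>0. \<forall>i. prob_space.expectation M (\<lambda>w. X t w $ i) = 0) \<and>
     (\<forall>s\<ge>0. \<forall>t\<ge>0. \<forall>i j. prob_space.expectation M (\<lambda>w. X s w $ i * X t w $ j) =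
        (if i = j then (s powr (2 * H) + t powr (2 * H) - \<bar>t - s\<bar> powr (2 * H)) / 2 else 0))"

text \<open>
  For \<open>0 < H < 1\<close> there is exactly one such \<open>P\<close>.
\<close>

definition wiener_measure :: "real \<Rightarrow> ('n::finite) path measure \<Rightarrow> bool" where
  "wiener_measure H P \<longleftrightarrow> prob_space P \<and> space P = path_space H \<and> sets P = sets (path_borel H) \<and>
     brownian_motion P (\<lambda>t w. w (- t))"

text \<open>
  \<open>fractional_operator H P \<alpha> DH\<close>: on \<open>path_space H\<close>, \<open>DH\<close> is the continuous extension of the
  integral operator, and \<open>\<alpha>\<close> is the positive constant that normalizes the image of \<open>P\<close> to the law
  of a time-reversed fractional Brownian motion. This determines \<open>\<alpha>\<close>, and \<open>DH\<close> on
  \<open>path_space H\<close>; the values of \<open>DH\<close> elsewhere are irrelevant.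
\<close>

definition fractional_operator ::
    "real \<Rightarrow> ('n::finite) path measure \<Rightarrow> real \<Rightarrow> ('n path \<Rightarrow> 'n path) \<Rightarrow> bool" where
  "fractional_operator H P \<alpha> DH \<longleftrightarrow>
     \<alpha> > 0 \<and>
     continuous_map (path_topology H) (path_topology (1 - H)) DH \<and>
     (\<forall>w\<in>smooth_paths. \<forall>t\<le>0. DH w t = (1 / \<alpha>) *\<^sub>R
        (LINT r:{..0}|lborel. ((- r) powr (H - 1/2)) *\<^sub>R
           (vector_derivative w (at (t + r) within {..0}) - vector_derivative w (at r within {..0})))) \<and>
     fractional_brownian_motion H (distr P (path_borel (1 - H)) DH) (\<lambda>t w. w (- t))"

definition back_shift :: "real \<Rightarrow> ('n::finite) path \<Rightarrow> 'n path" where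
  "back_shift t w = (\<lambda>s. if s \<le> 0 then w (s - t) - w (- t) else 0)"

definition glue :: "real \<Rightarrow> ('n::finite) path \<times> 'n path \<Rightarrow> 'n path" where
  "glue t = (\<lambda>(wm, wp) s.
     if s > 0 then 0
     else if - t \<le> s then wp (- s - t) - wp (- t)
     else wm (s + t) - wp (- t))"

definition wiener_shift ::
    "real \<Rightarrow> ('n::finite) path \<times> 'n path \<Rightarrow> 'n path \<times> 'n path" where
  "wiener_shift t = (\<lambda>(wm, wp).
     if t \<ge> 0 then (glue t (wm, wp), back_shift t wp)
     else (back_shift (- t) wm, glue (- t) (wp, wm)))"

definition fbm ::
    "(('n::finite) path \<Rightarrow> 'n path) \<Rightarrow> real \<Rightarrow> 'n path \<times> 'n path \<Rightarrow> real ^ 'n" where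
  "fbm DH t w = - DH (glue t w) (- t)"

definition sde_solution ::
    "(real ^ 'n \<Rightarrow> real ^ 'n) \<Rightarrow> real ^ 'n ^ 'n \<Rightarrow> (('n::finite) path \<Rightarrow> 'n path) \<Rightarrow>
     'n path \<times> 'n path \<Rightarrow> real ^ 'n \<Rightarrow> (real \<Rightarrow> real ^ 'n) \<Rightarrow> bool" where
  "sde_solution F \<sigma> DH w x y \<longleftrightarrow>
     continuous_on {0..} y \<and>
     (\<forall>t\<ge>0. y t = x + integral {0..t} (\<lambda>s. F (y s)) + \<sigma> *v fbm DH t w)"

text \<open>
  In \<open>cocycle \<Phi> t wm x\<close> the second component of the noise is set to the zero path; on \<open>[0, t]\<close> the
  noise shifted by \<open>wiener_shift (- t)\<close> depends only on \<open>wm\<close>, so this choice is immaterial.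
\<close>

definition cocycle ::
    "(real \<Rightarrow> ('n::finite) path \<times> 'n path \<Rightarrow> real ^ 'n \<Rightarrow> real ^ 'n) \<Rightarrow>
     real \<Rightarrow> 'n path \<Rightarrow> real ^ 'n \<Rightarrow> real ^ 'n" where
  "cocycle \<Phi> t wm x = \<Phi> t (wiener_shift (- t) (wm, \<lambda>_. 0)) x"

definition standing_conditions ::
    "real \<Rightarrow> (real ^ 'n \<Rightarrow> real ^ 'n) \<Rightarrow> real ^ 'n ^ ('n::finite) \<Rightarrow>
     real \<Rightarrow> real \<Rightarrow> real \<Rightarrow> real \<Rightarrow> nat \<Rightarrow> bool" where
  "standing_conditions H F \<sigma> C1 C2 C3 CF N \<longleftrightarrow>
     invertible \<sigma> \<and>
     C1 > 0 \<and> C2 > 0 \<and> C3 > 0 \<and>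
     (\<forall>\<xi>1 \<xi>2. (F \<xi>2 - F \<xi>1) \<bullet> (\<xi>2 - \<xi>1) \<le>
        min (C1 - C2 * (norm (\<xi>2 - \<xi>1))\<^sup>2) (C3 * (norm (\<xi>2 - \<xi>1))\<^sup>2)) \<and>
     (\<forall>\<xi>. F differentiable (at \<xi>)) \<and>
     CF > 0 \<and> N \<ge> 1 \<and>
     (\<forall>\<xi>. norm (F \<xi>) \<le> CF * (1 + norm \<xi>) ^ N) \<and>
     (\<forall>\<xi>. onorm (frechet_derivative F (at \<xi>)) \<le> CF * (1 + norm \<xi>) ^ N) \<and>
     (H > 1/2 \<longrightarrow> (\<exists>K. \<forall>\<xi>. onorm (frechet_derivative F (at \<xi>)) \<le> K))"

definition eventually_strictly_monotone ::
    "(real ^ 'n \<Rightarrow> real ^ ('n::finite)) \<Rightarrow> real \<Rightarrow> real \<Rightarrow> bool" where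
  "eventually_strictly_monotone F R C4 \<longleftrightarrow> R > 0 \<and> C4 > 0 \<and>
     (\<forall>x y. norm x \<ge> R \<and> norm y \<ge> R \<longrightarrow> (F x - F y) \<bullet> (x - y) \<le> - C4 * (norm (x - y))\<^sup>2)"

definition transition_prob ::
    "('n::finite) path measure \<Rightarrow> (real \<Rightarrow> 'n path \<times> 'n path \<Rightarrow> real ^ 'n \<Rightarrow> real ^ 'n) \<Rightarrow>
     real \<Rightarrow> (real ^ 'n) \<times> 'n path \<Rightarrow> ((real ^ 'n) \<times> 'n path) set \<Rightarrow> ennreal" where
  "transition_prob P \<Phi> t = (\<lambda>(x, wm) \<Gamma>.
     \<integral>\<^sup>+ wp. indicator \<Gamma> (cocycle \<Phi> t (glue t (wm, wp)) x, glue t (wm, wp)) \<partial>P)"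

definition invariant_measure ::
    "('n::finite) path measure \<Rightarrow> (real \<Rightarrow> 'n path \<times> 'n path \<Rightarrow> real ^ 'n \<Rightarrow> real ^ 'n) \<Rightarrow>
     ((real ^ 'n) \<times> 'n path) measure \<Rightarrow> bool" where
  "invariant_measure P \<Phi> \<mu> \<longleftrightarrow>
     prob_space \<mu> \<and> sets \<mu> = sets (borel \<Otimes>\<^sub>M P) \<and> distr \<mu> P snd = P \<and>
     (\<forall>t\<ge>0. \<forall>\<Gamma>\<in>sets \<mu>. (\<integral>\<^sup>+ z. transition_prob P \<Phi> t z \<Gamma> \<partial>\<mu>) = emeasure \<mu> \<Gamma>)"

definition disintegration ::
    "('n::finite) path measure \<Rightarrow> (real \<Rightarrow> 'n path \<times> 'n path \<Rightarrow> real ^ 'n \<Rightarrow> real ^ 'n) \<Rightarrow>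
     ((real ^ 'n) \<times> 'n path) measure \<Rightarrow> 'n path set \<Rightarrow> ('n path \<Rightarrow> (real ^ 'n) measure) \<Rightarrow> bool" where
  "disintegration P \<Phi> \<mu> Bt \<kappa> \<longleftrightarrow>
     Bt \<in> sets P \<and> emeasure P Bt = 1 \<and>
     (\<forall>w\<in>space P. prob_space (\<kappa> w) \<and> sets (\<kappa> w) = sets borel) \<and>
     (\<forall>A\<in>sets borel. (\<lambda>w. emeasure (\<kappa> w) A) \<in> borel_measurable P) \<and>
     (\<forall>A\<in>sets borel. \<forall>D\<in>sets P. emeasure \<mu> (A \<times> D) = (\<integral>\<^sup>+ w\<in>D. emeasure (\<kappa> w) A \<partial>P)) \<and>
     (\<forall>wm\<in>Bt. \<forall>wp\<in>space P. \<forall>t\<ge>0.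
        glue t (wm, wp) \<in> Bt \<and> distr (\<kappa> wm) borel (\<Phi> t (wm, wp)) = \<kappa> (glue t (wm, wp)))"

definition measure_support :: "'a::topological_space measure \<Rightarrow> 'a set" where
  "measure_support \<nu> = {x. \<forall>U. open U \<and> x \<in> U \<longrightarrow> emeasure \<nu> U > 0}"

definition support_diameter ::
    "nat \<Rightarrow> (nat \<Rightarrow> ('n::finite) path \<Rightarrow> real ^ 'n) \<Rightarrow> 'n path \<Rightarrow> real" where
  "support_diameter p b w = (if p = 1 then 0
     else Max {norm (b i w - b j w) | i j. i \<in> {1..p} \<and> j \<in> {1..p} \<and> i \<noteq> j})"

definition finite_support_condition ::
    "('n::finite) path measure \<Rightarrow> 'n path set \<Rightarrow> ('n path \<Rightarrow> (real ^ 'n) measure) \<Rightarrow>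
     nat \<Rightarrow> (nat \<Rightarrow> 'n path \<Rightarrow> real ^ 'n) \<Rightarrow> real \<Rightarrow> bool" where
  "finite_support_condition P Bt \<kappa> p b C \<longleftrightarrow>
     p \<ge> 1 \<and> C > 0 \<and>
     (\<forall>i\<in>{1..p}. b i \<in> borel_measurable (restrict_space P Bt)) \<and>
     (\<forall>w\<in>Bt. measure_support (\<kappa> w) = {b i w | i. i \<in> {1..p}}) \<and>
     (\<forall>w\<in>Bt. support_diameter p b w \<le> C) \<and>
     (\<forall>t\<ge>0. wiener_shift t ` (Bt \<times> space P) \<subseteq> Bt \<times> space P)"

definition weak_synchronization ::
    "('n::finite) path measure \<Rightarrow> 'n path set \<Rightarrow> ('n path \<Rightarrow> (real ^ 'n) measure) \<Rightarrow> bool" where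
  "weak_synchronization P Bt \<kappa> \<longleftrightarrow>
     (\<exists>b \<in> borel_measurable (restrict_space P Bt).
        AE w in P. w \<in> Bt \<longrightarrow> measure_support (\<kappa> w) = {b w})"

end

(*
  Almost surely, the drift contracts the distances from a point of the support of \<kappa> w to all others at
  rate C4 while that point is outside the ball of radius R + C, since then the whole support is outside
  the ball of radius R; otherwise they grow at rate at most C3. Let reach (x, w) be the largest
  distance from x to the support of \<kappa> w. If it were positive almost surely, then the stationarity of
  ln (reach (x, w)) under \<mu> would force a solution with initial law \<pi> to meet the closed ball during [0, d] with
  probability at least C4 / (C3 + C4) for every d > 0, and d \<rightarrow> 0 contradicts the hypothesis on \<pi>. This
  needs neither Birkhoff's theorem nor integrability of the logarithm. So the support is a single point
  with positive probability. This event is forward invariant under the noise, and the noise forgets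
  its past, so the event has probability 1.

  The measurability behind the argument rests on two facts: the path space is separable, hence its
  Borel sets are generated by evaluations, and the solution is a limit of Euler schemes.
*)
theory Submission
  imports Defs
begin

section \<open>The space of paths\<close>

text \<open>The threshold balances two rates. If q is the probability of meeting the closed ball
  within a time d, then, formally, the mean change of the logarithm of \<open>reach\<close> is at
  most C3 * d * q - C4 * d * (1 - q), while stationarity makes it 0; d cancels and q \<ge> C4 / (C3
  + C4) is left. The logarithm is taken because the pathwise estimates are multiplicative. The
  distance is measured from one point x, not as the diameter of the support, for two reasons: the
  hypothesis speaks only about the law of a single solution, and the pair (x, w) is the object whose
  law is stationary. One point outside the larger ball controls every pair that contains it. The
  main obstacle is measurability. \<open>\<Phi>\<close> is given only as a family of pathwise
  solutions, and the equality of laws before and after a time step can be used only once that step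
  is known to be a measurable map. This accounts for the separability of the path space and for the
  Euler schemes.\<close>

definition holder_weight :: "real \<Rightarrow> real \<Rightarrow> real \<Rightarrow> real" where
  "holder_weight h s t = sqrt (1 + \<bar>t\<bar> + \<bar>s\<bar>) * \<bar>t - s\<bar> powr ((1 - h) / 2)"

text \<open>Multiplied out, the condition avoids extended reals, and at s = t it reads 0 \<le> 0
  instead of containing a quotient.\<close>

definition holder_le :: "real \<Rightarrow> real \<Rightarrow> ('n::finite) path \<Rightarrow> bool" where
  "holder_le h c w \<longleftrightarrow> (\<forall>s\<le>0. \<forall>t\<le>0. norm (w t - w s) \<le> c * holder_weight h s t)"

lemma holder_weight_nonneg: "0 \<le> holder_weight h s t"
  by (simp add: holder_weight_def)

lemma holder_weight_pos: "s \<noteq> t \<Longrightarrow> 0 < holder_weight h s t"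
  by (simp add: holder_weight_def add_pos_nonneg)

lemma holder_norm_le_iff:
  assumes "0 \<le> c"
  shows "holder_norm h w \<le> ereal c \<longleftrightarrow> holder_le h c w"
proof -
  have "norm (w t - w s) / holder_weight h s t \<le> c \<longleftrightarrow> norm (w t - w s) \<le> c * holder_weight h s t"
    for s t
  proof (cases "s = t")
    case True
    then show ?thesis using assms by (simp add: holder_weight_nonneg)
  next
    case False
    then show ?thesis using holder_weight_pos[OF False] by (simp add: pos_divide_le_eq)
  qed
  then show ?thesis
    unfolding holder_norm_def holder_le_def SUP_le_iff holder_weight_def[symmetric] by auto
qed

lemma holder_norm_nonneg: "0 \<le> holder_norm h w"
  unfolding holder_norm_def
  by (rule SUP_upper2[of 0], simp, rule SUP_upper2[of 0]) auto

lemma holder_norm_finite_iff: "holder_norm h w < \<infinity> \<longleftrightarrow> (\<exists>c\<ge>0. holder_le h c w)"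
proof
  assume "holder_norm h w < \<infinity>"
  then obtain c where "holder_norm h w = ereal c"
    using holder_norm_nonneg[of h w] by (cases "holder_norm h w") auto
  then show "\<exists>c\<ge>0. holder_le h c w"
    using holder_norm_nonneg[of h w] holder_norm_le_iff[of c h w] by auto
next
  assume "\<exists>c\<ge>0. holder_le h c w"
  then show "holder_norm h w < \<infinity>"
    by (metis ereal_less_PInfty holder_norm_le_iff less_eq_ereal_def less_ereal.simps(4) order_le_less_trans)
qed

lemma holder_le_add:
  assumes "holder_le h c v" "holder_le h d w"
  shows "holder_le h (c + d) (\<lambda>t. v t + w t)"
  unfolding holder_le_def
proof (intro allI impI)
  fix s t :: real assume "s \<le> 0" "t \<le> 0"
  then have "norm (v t - v s) \<le> c * holder_weight h s t" "norm (w t - w s) \<le> d * holder_weight h s t"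
    using assms by (auto simp: holder_le_def)
  moreover have "norm (v t + w t - (v s + w s)) \<le> norm (v t - v s) + norm (w t - w s)"
    by (metis add_diff_add norm_triangle_ineq)
  ultimately show "norm (v t + w t - (v s + w s)) \<le> (c + d) * holder_weight h s t"
    by (simp add: algebra_simps)
qed

lemma holder_le_minus: "holder_le h c (\<lambda>t. - w t) \<longleftrightarrow> holder_le h c w"
  by (simp add: holder_le_def norm_minus_commute)

lemma holder_le_diff:
  assumes "holder_le h c v" "holder_le h d w"
  shows "holder_le h (c + d) (\<lambda>t. v t - w t)"
  using holder_le_add[OF assms(1), of d "\<lambda>t. - w t"] assms(2) by (simp add: holder_le_minus)

text \<open>Two regimes. At distances up to 1 the Lipschitz bound suffices, because the exponent (1
  - h) / 2 is below 1; at larger distances the power is at least 1, and two values of size at most M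
  differ by at most 2 * M. The square root in the weight is at least 1.\<close>

lemma holder_le_lipschitz_bounded:
  assumes h: "0 < h" "h < 1"
    and lip: "\<And>s t. s \<le> 0 \<Longrightarrow> t \<le> 0 \<Longrightarrow> norm (w t - w s) \<le> M * \<bar>t - s\<bar>"
    and bnd: "\<And>t. t \<le> 0 \<Longrightarrow> norm (w t) \<le> M"
  shows "holder_le h (2 * M) w"
  unfolding holder_le_def
proof (intro allI impI)
  fix s t :: real assume st: "s \<le> 0" "t \<le> 0"
  have M: "0 \<le> M" using bnd[of 0] norm_ge_zero[of "w 0"] by linarith
  have sq: "1 \<le> sqrt (1 + \<bar>t\<bar> + \<bar>s\<bar>)" by simp
  have "norm (w t - w s) \<le> (2 * M) * \<bar>t - s\<bar> powr ((1 - h) / 2)"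
  proof (cases "\<bar>t - s\<bar> \<le> 1")
    case True
    have "\<bar>t - s\<bar> \<le> \<bar>t - s\<bar> powr ((1 - h) / 2)"
      using powr_mono'[of "(1 - h) / 2" 1 "\<bar>t - s\<bar>"] True h by simp
    then have "M * \<bar>t - s\<bar> \<le> M * \<bar>t - s\<bar> powr ((1 - h) / 2)"
      using M by (rule mult_left_mono)
    moreover have "0 \<le> M * \<bar>t - s\<bar> powr ((1 - h) / 2)" using M by simp
    ultimately show ?thesis using lip[OF st] by linarith
  next
    case False
    then have "1 \<le> \<bar>t - s\<bar> powr ((1 - h) / 2)" using h by (intro ge_one_powr_ge_zero) auto
    then have "2 * M * 1 \<le> 2 * M * \<bar>t - s\<bar> powr ((1 - h) / 2)"
      using M by (intro mult_left_mono) auto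
    moreover have "norm (w t - w s) \<le> 2 * M"
      using norm_triangle_ineq4[of "w t" "w s"] bnd[OF st(1)] bnd[OF st(2)] by linarith
    ultimately show ?thesis by linarith
  qed
  also have "\<dots> = 1 * ((2 * M) * \<bar>t - s\<bar> powr ((1 - h) / 2))" by simp
  also have "\<dots> \<le> sqrt (1 + \<bar>t\<bar> + \<bar>s\<bar>) * ((2 * M) * \<bar>t - s\<bar> powr ((1 - h) / 2))"
    using M sq by (intro mult_right_mono) auto
  finally show "norm (w t - w s) \<le> 2 * M * holder_weight h s t"
    by (simp add: holder_weight_def mult_ac)
qed

text \<open>The mean value inequality gives the Lipschitz constant M; as \<open>w\<close> vanishes
  at 0 and before - T, it also bounds the values. The factor T + 1 dominates both constants. This is
  what converts closeness of derivatives into closeness in the Holder norm.\<close>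

lemma holder_le_C1:
  fixes w :: "('n::finite) path"
  assumes h: "0 < h" "h < 1" and T: "0 \<le> T"
    and der: "\<And>t. t \<le> 0 \<Longrightarrow> (w has_vector_derivative D t) (at t within {..0})"
    and D: "\<And>t. t \<le> 0 \<Longrightarrow> norm (D t) \<le> M"
    and supp: "\<And>t. t < - T \<Longrightarrow> w t = 0" and w0: "w 0 = 0"
  shows "holder_le h (2 * ((T + 1) * M)) w"
proof (rule holder_le_lipschitz_bounded[OF h])
  have M: "0 \<le> M" using D[of 0] norm_ge_zero[of "D 0"] by linarith
  have lip: "norm (w t - w s) \<le> M * \<bar>t - s\<bar>" if "s \<le> 0" "t \<le> 0" for s t
  proof -
    have "norm (w t - w s) \<le> M * norm (t - s)"
    proof (rule differentiable_bound[of "{..0}"])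
      show "(w has_derivative (\<lambda>x. x *\<^sub>R D r)) (at r within {..0})" if "r \<in> {..0}" for r
        using der that by (simp add: has_vector_derivative_def)
      show "onorm (\<lambda>x. x *\<^sub>R D r) \<le> M" if "r \<in> {..0}" for r
        using that D[of r] by (intro onorm_bound) (auto simp: M mult.commute[of M] intro: mult_left_mono)
    qed (use that in auto)
    then show ?thesis by simp
  qed
  show "norm (w t - w s) \<le> (T + 1) * M * \<bar>t - s\<bar>" if "s \<le> 0" "t \<le> 0" for s t
  proof -
    have "0 \<le> T * M * \<bar>t - s\<bar>" using T M by simp
    then show ?thesis using lip[OF that] by (simp add: algebra_simps)
  qed
  show "norm (w t) \<le> (T + 1) * M" if "t \<le> 0" for t
  proof (cases "t < - T")
    case True
    then show ?thesis using supp T M by simp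
  next
    case False
    have "norm (w t) \<le> M * \<bar>t\<bar>" using lip[of 0 t] that w0 by simp
    also have "\<dots> \<le> M * (T + 1)" using False that M by (intro mult_left_mono) auto
    finally show ?thesis by (simp add: mult.commute)
  qed
qed

section \<open>Smooth paths and their separability in the Holder norm\<close>

lemma smooth_pathsE:
  fixes w :: "('n::finite) path"
  assumes "w \<in> smooth_paths"
  obtains T :: nat and D where
    "\<And>t. t \<le> 0 \<Longrightarrow> (w has_vector_derivative D t) (at t within {..0})"
    "continuous_on {..0} D" "\<And>t. t < - real T \<Longrightarrow> w t = 0 \<and> D t = 0" "w 0 = 0"
proof -
  from assms obtain D where w: "w 0 = 0" "bounded {t. w t \<noteq> 0}" "\<And>t. t \<le> 0 \<Longrightarrow> D 0 t = w t"
    and D: "\<And>k t. t \<le> 0 \<Longrightarrow> (D k has_vector_derivative D (Suc k) t) (at t within {..0})"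
    by (auto simp: smooth_paths_def)
  obtain B where B: "\<And>t. w t \<noteq> 0 \<Longrightarrow> \<bar>t\<bar> \<le> B"
    using w(2) unfolding bounded_iff by auto
  obtain T :: nat where T: "B < real T" using reals_Archimedean2 by blast
  have supp: "w t = 0" if "t < - real T" for t using B[of t] T that by fastforce
  have der: "(w has_vector_derivative D 1 t) (at t within {..0})" if "t \<le> 0" for t
    using has_vector_derivative_transform[of t "{..0}" w "D 0" "D 1 t"] D[of t 0] w(3) that by simp
  have "D 1 t = 0" if t: "t < - real T" for t
  proof -
    have t0: "t < 0" using t by (smt (verit) of_nat_0_le_iff)
    have "(w has_vector_derivative D 1 t) (at t)"
      using der[of t] t0 at_within_interior[of t "{..0::real}"] by simp
    \<comment> \<open>The strict inequality makes the region before - T open, so \<open>w\<close> is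
      locally zero at t and its derivative vanishes too.\<close>
    moreover have "(w has_vector_derivative 0) (at t)"
    proof (rule has_vector_derivative_transform_within_open)
      show "((\<lambda>_. 0) has_vector_derivative 0) (at t)" by simp
      show "open {..< - real T}" "t \<in> {..< - real T}" using t by auto
      show "0 = w x" if "x \<in> {..< - real T}" for x using supp that by simp
    qed
    ultimately show ?thesis by (rule vector_derivative_unique_at)
  qed
  moreover have "continuous_on {..0} (D 1)"
    using D[of _ 1] has_vector_derivative_continuous[of "D 1" "D (Suc 1) _" _ "{..0}"]
    by (fastforce simp: continuous_on_eq_continuous_within)
  ultimately show thesis using that[of "D 1" T] der supp w(1) by blast
qed

lemma smooth_paths_diff:
  assumes "v \<in> smooth_paths" "w \<in> smooth_paths"
  shows "(\<lambda>t. v t - w t) \<in> smooth_paths"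
proof -
  from assms obtain D E where
    D: "\<And>t. t \<le> 0 \<Longrightarrow> D 0 t = v t" "\<And>k t. t \<le> 0 \<Longrightarrow> (D k has_vector_derivative D (Suc k) t) (at t within {..0})"
    and E: "\<And>t. t \<le> 0 \<Longrightarrow> E 0 t = w t" "\<And>k t. t \<le> 0 \<Longrightarrow> (E k has_vector_derivative E (Suc k) t) (at t within {..0})"
    by (auto simp: smooth_paths_def)
  have "bounded {t. v t - w t \<noteq> 0}"
    by (rule bounded_subset[of "{t. v t \<noteq> 0} \<union> {t. w t \<noteq> 0}"]) (use assms in \<open>auto simp: smooth_paths_def\<close>)
  moreover have "\<exists>D. (\<forall>t\<le>0. D 0 t = v t - w t) \<and>
          (\<forall>k::nat. \<forall>t\<le>0. (D k has_vector_derivative D (Suc k) t) (at t within {..0}))"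
    using D E by (intro exI[of _ "\<lambda>k t. D k t - E k t"]) (auto intro!: derivative_intros)
  ultimately show ?thesis using assms by (auto simp: smooth_paths_def)
qed

lemma smooth_paths_zero: "(\<lambda>_. 0) \<in> smooth_paths"
  unfolding smooth_paths_def by (auto intro!: exI[of _ "\<lambda>_ _. 0"])

lemma smooth_paths_holder:
  assumes h: "0 < h" "h < 1" and w: "w \<in> smooth_paths"
  shows "holder_norm h w < \<infinity>"
proof -
  obtain T :: nat and D where D:
    "\<And>t. t \<le> 0 \<Longrightarrow> (w has_vector_derivative D t) (at t within {..0})"
    "continuous_on {..0} D" "\<And>t. t < - real T \<Longrightarrow> w t = 0 \<and> D t = 0" "w 0 = 0"
    using smooth_pathsE[OF w] by metis
  have "compact (D ` {- real T..0})"
    by (intro compact_continuous_image continuous_on_subset[OF D(2)]) auto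
  then have "bounded (D ` {- real T..0})" by (rule compact_imp_bounded)
  then obtain M where M: "\<And>t. t \<in> {- real T..0} \<Longrightarrow> norm (D t) \<le> M"
    unfolding bounded_iff by (metis imageI)
  have "0 \<le> M" using M[of 0] order_trans[OF norm_ge_zero] by auto
  have "norm (D t) \<le> M" if "t \<le> 0" for t
    using M[of t] D(3)[of t] \<open>0 \<le> M\<close> that by (cases "t < - real T") auto
  then have "holder_le h (2 * ((real T + 1) * M)) w"
    using D by (intro holder_le_C1[OF h]) auto
  moreover have "0 \<le> 2 * ((real T + 1) * M)" using \<open>0 \<le> M\<close> by simp
  ultimately show ?thesis unfolding holder_norm_finite_iff by blast
qed

text \<open>One representative per code, chosen by \<open>inv_into\<close>, gives a countable net
  inside \<open>S\<close> itself. Codes are never decoded, so they need not describe elements of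
  \<open>S\<close> exactly.\<close>

lemma countable_code:
  assumes "countable (c ` S)" and "\<And>v w. v \<in> S \<Longrightarrow> w \<in> S \<Longrightarrow> c v = c w \<Longrightarrow> R w v"
  shows "\<exists>Q\<subseteq>S. countable Q \<and> (\<forall>w\<in>S. \<exists>v\<in>Q. R w v)"
proof (intro exI[of _ "inv_into S c ` c ` S"] conjI ballI)
  show "inv_into S c ` c ` S \<subseteq> S" by (auto intro!: inv_into_into)
  show "countable (inv_into S c ` c ` S)" using assms(1) by simp
  fix w assume "w \<in> S"
  then show "\<exists>v\<in>inv_into S c ` c ` S. R w v"
    by (intro bexI[of _ "inv_into S c (c w)"] assms(2)) (auto simp: inv_into_into f_inv_into_f)
qed

text \<open>A smooth path is coded by its support and by approximate values of its derivative at the points of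
  a sufficiently fine grid.\<close>

lemma smooth_paths_net:
  fixes e :: real
  assumes h: "0 < h" "h < 1" and e: "0 < e"
  shows "\<exists>Q\<subseteq>smooth_paths. countable Q \<and> 
    (\<forall>w\<in>smooth_paths. \<exists>v\<in>Q. holder_norm h (\<lambda>t. w t - v t :: real^('n::finite)) < ereal e)"
proof -
  obtain Q :: "(real^'n) set" where Q: "countable Q" "\<And>X. open X \<Longrightarrow> X \<noteq> {} \<Longrightarrow> \<exists>q\<in>Q. q \<in> X"
    by (rule countable_dense_setE) auto
  define good where "good w T D \<longleftrightarrow> 
    (\<forall>t. t \<le> 0 \<longrightarrow> (w has_vector_derivative D t) (at t within {..0})) \<and>
    continuous_on {..0} D \<and> (\<forall>t. t < - real T \<longrightarrow> w t = 0 \<and> D t = 0) \<and> w 0 = 0"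
    for w :: "'n path" and T :: nat and D
  \<comment> \<open>The tolerance is dictated by the end of the proof: equal codes give derivatives
    at most 2 * e / (8 * (T + 1)) apart, and \<open>holder_le_C1\<close> multiplies this by 2 * (T +
    1), which leaves e / 2. The index rounds t to a grid point towards 0.\<close>
  define approx where "approx w T m q \<longleftrightarrow> (\<exists>D. good w T D \<and> 
      (\<forall>t\<in>{-real T..0}. norm (D t - q ! nat \<lfloor>real (Suc m) * - t\<rfloor>) < e / (8 * (real T + 1))))"
    for w T m q
  have "\<forall>w\<in>smooth_paths. \<exists>T m q. q \<in> lists Q \<and> approx w T m q"
  proof
    fix w :: "'n path" assume "w \<in> smooth_paths"
    then obtain T D where g: "good w T D" using smooth_pathsE[of w] unfolding good_def by metis
    define d where "d = e / (8 * (real T + 1))"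
    have d: "d > 0" using e by (simp add: d_def)
    have "uniformly_continuous_on {-real T..0} D"
      using g by (intro compact_uniformly_continuous) (auto simp: good_def intro: continuous_on_subset)
    then obtain r where r: "r > 0" "\<And>s t. s \<in> {-real T..0} \<Longrightarrow> t \<in> {-real T..0} \<Longrightarrow> dist s t < r \<Longrightarrow> dist (D s) (D t) < d / 2"
      using d unfolding uniformly_continuous_on_def by (metis half_gt_zero)
    obtain m where m: "1 / real (Suc m) < r" using r(1) nat_approx_posE by blast
    have "\<exists>q\<in>Q. dist (D (- real i / real (Suc m))) q < d / 2" for i
      using Q(2)[of "ball (D (- real i / real (Suc m))) (d / 2)"] d by auto
    then obtain q where q: "\<And>i. q i \<in> Q" "\<And>i. dist (D (- real i / real (Suc m))) (q i) < d / 2"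
      by metis
    \<comment> \<open>The time - T has index T * Suc m, hence the additional entry.\<close>
    define L where "L = map q [0..<Suc (T * Suc m)]"
    have "norm (D t - L ! nat \<lfloor>real (Suc m) * - t\<rfloor>) < d" if t: "t \<in> {-real T..0}" for t
    proof -
      define i where "i = nat \<lfloor>real (Suc m) * - t\<rfloor>"
      have "0 \<le> real (Suc m) * - t" using t by (intro mult_nonneg_nonneg) auto
      then have i: "real i \<le> real (Suc m) * - t" "real (Suc m) * - t < real i + 1"
        unfolding i_def by linarith+
      have "real (Suc m) * - t \<le> real (Suc m) * real T" using t by (intro mult_left_mono) auto
      then have "real i \<le> real (Suc m) * real T" using i(1) by (rule order_trans[rotated])
      then have iT: "i \<le> T * Suc m" by (simp only: of_nat_mult[symmetric] of_nat_le_iff mult.commute)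
      then have Li: "L ! i = q i" unfolding L_def by (subst nth_map) (auto simp del: upt_Suc)
      define s where "s = - real i / real (Suc m)"
      have mpos: "0 < real (Suc m)" by simp
      have "real i / real (Suc m) \<le> - t"
        using i(1) by (simp only: pos_divide_le_eq[OF mpos] mult.commute)
      moreover have "- t < (real i + 1) / real (Suc m)"
        using i(2) by (simp only: pos_less_divide_eq[OF mpos] mult.commute)
      moreover have "0 \<le> real i / real (Suc m)" by simp
      ultimately have s1: "t \<le> s" "s \<le> 0" and "s - t < 1 / real (Suc m)"
        unfolding s_def minus_divide_left[symmetric] add_divide_distrib by linarith+
      then have "dist t s < r" using s1 m unfolding dist_real_def by linarith
      then have "dist (D t) (D s) < d / 2" using s1 t by (intro r(2)) auto
      then show ?thesis using q(2)[of i] Li unfolding i_def[symmetric] s_def dist_norm[symmetric]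
        using dist_triangle_half_l[of "D t" "D (- real i / real (Suc m))" d "q i"]
        by (simp add: dist_commute)
    qed
    then have "approx w T m L" using g unfolding approx_def d_def by blast
    moreover have "L \<in> lists Q" using q(1) by (auto simp: L_def)
    ultimately show "\<exists>T m q. q \<in> lists Q \<and> approx w T m q" by blast
  qed
  then obtain T m q where c: "\<And>w. w \<in> smooth_paths \<Longrightarrow> q w \<in> lists Q \<and> approx w (T w) (m w) (q w)"
    by metis
  show ?thesis
  proof (rule countable_code)
    show "countable ((\<lambda>w. (T w, m w, q w)) ` smooth_paths)"
      by (rule countable_subset[of _ "UNIV \<times> UNIV \<times> lists Q"]) (use c Q(1) in auto)
    fix v w :: "'n path"
    assume vw: "v \<in> smooth_paths" "w \<in> smooth_paths" "(T v, m v, q v) = (T w, m w, q w)"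
    define S n p where "S = T v" and "n = m v" and "p = q v"
    have "approx v S n p" using c[OF vw(1)] by (simp add: S_def n_def p_def)
    then obtain D where D: "good v S D"
      "\<And>t. t \<in> {-real S..0} \<Longrightarrow> norm (D t - p ! nat \<lfloor>real (Suc n) * - t\<rfloor>) < e / (8 * (real S + 1))"
      unfolding approx_def by blast
    have "approx w S n p" using c[OF vw(2)] vw(3) by (simp add: S_def n_def p_def)
    then obtain E where E: "good w S E"
      "\<And>t. t \<in> {-real S..0} \<Longrightarrow> norm (E t - p ! nat \<lfloor>real (Suc n) * - t\<rfloor>) < e / (8 * (real S + 1))"
      unfolding approx_def by blast
    define d where "d = e / (8 * (real S + 1))"
    have d: "d > 0" using e by (simp add: d_def)
    have "holder_le h (2 * ((real S + 1) * (2 * d))) (\<lambda>t. w t - v t)"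
    proof (rule holder_le_C1[OF h])
      show "((\<lambda>t. w t - v t) has_vector_derivative E t - D t) (at t within {..0})" if "t \<le> 0" for t
        using D E that by (auto simp: good_def intro!: derivative_intros)
      show "norm (E t - D t) \<le> 2 * d" if "t \<le> 0" for t
      proof (cases "t < - real S")
        case True
        then show ?thesis using D E d by (auto simp: good_def)
      next
        case False
        then have "t \<in> {-real S..0}" using that by auto
        then show ?thesis using D(2)[of t, folded d_def] E(2)[of t, folded d_def]
          norm_triangle_ineq4[of "E t - p ! nat \<lfloor>real (Suc n) * - t\<rfloor>" "D t - p ! nat \<lfloor>real (Suc n) * - t\<rfloor>"]
          by simp
      qed
    qed (use D E in \<open>auto simp: good_def\<close>)
    moreover have "2 * ((real S + 1) * (2 * d)) = e / 2" by (simp add: d_def divide_simps)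
    ultimately have "holder_norm h (\<lambda>t. w t - v t) \<le> ereal (e / 2)"
      using e by (subst holder_norm_le_iff) auto
    also have "\<dots> < ereal e" using e by simp
    finally show "holder_norm h (\<lambda>t. w t - v t) < ereal e" .
  qed
qed

section \<open>The path space as a separable metric space\<close>

lemma path_space_finite:
  assumes h: "0 < h" "h < 1" and w: "w \<in> path_space h"
  shows "\<exists>c\<ge>0. holder_le h c w"
proof -
  obtain f where f: "f \<in> smooth_paths" "holder_norm h (\<lambda>t. w t - f t) < ereal 1"
    using w unfolding path_space_def by (auto dest: spec[of _ 1])
  then have "holder_norm h (\<lambda>t. w t - f t) < \<infinity>" by (auto intro: less_trans)
  then obtain c where c: "c \<ge> 0" "holder_le h c (\<lambda>t. w t - f t)" unfolding holder_norm_finite_iff by blast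
  obtain d where d: "d \<ge> 0" "holder_le h d f"
    using smooth_paths_holder[OF h f(1)] unfolding holder_norm_finite_iff by blast
  have "holder_le h (c + d) w" using holder_le_add[OF c(2) d(2)] by simp
  then show ?thesis using c(1) d(1) by (metis add_nonneg_nonneg)
qed

lemma smooth_subset_path_space: "smooth_paths \<subseteq> (path_space h :: ('a::finite) path set)"
proof
  fix w :: "('a::finite) path" assume w: "w \<in> smooth_paths"
  have "holder_norm h (\<lambda>t. w t - w t) \<le> ereal 0"
    unfolding holder_norm_le_iff[OF order_refl] by (simp add: holder_le_def)
  then have "holder_norm h (\<lambda>t. w t - w t) < ereal e" if "e > 0" for e
    using that by (metis ereal_less(2) order_le_less_trans zero_ereal_def)
  moreover have "\<forall>t>0. w t = 0" "w 0 = 0" using w by (auto simp: smooth_paths_def)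
  ultimately show "w \<in> path_space h" using w unfolding path_space_def by blast
qed

lemma path_space_zero: "(\<lambda>_. 0) \<in> path_space h"
  using smooth_subset_path_space smooth_paths_zero by blast

lemma path_space_diff:
  assumes v: "v \<in> path_space h" and w: "w \<in> path_space h"
  shows "(\<lambda>t. v t - w t) \<in> path_space h"
proof -
  have "\<exists>f\<in>smooth_paths. holder_norm h (\<lambda>t. v t - w t - f t) < ereal e" if e: "e > 0" for e
  proof -
    have e3: "e / 3 > 0" using e by simp
    obtain f where f: "f \<in> smooth_paths" "holder_norm h (\<lambda>t. v t - f t) < ereal (e/3)"
      using v e3 unfolding path_space_def by blast
    obtain g where g: "g \<in> smooth_paths" "holder_norm h (\<lambda>t. w t - g t) < ereal (e/3)"
      using w e3 unfolding path_space_def by blast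
    have "holder_le h (e/3) (\<lambda>t. v t - f t)" "holder_le h (e/3) (\<lambda>t. w t - g t)"
      using f(2) g(2) e3 by (simp_all flip: holder_norm_le_iff)
    then have "holder_le h (e/3 + e/3) (\<lambda>t. (v t - f t) - (w t - g t))" by (rule holder_le_diff)
    then have "holder_norm h (\<lambda>t. v t - w t - (f t - g t)) \<le> ereal (e/3 + e/3)"
      using e3 by (subst holder_norm_le_iff) (auto simp: algebra_simps)
    also have "\<dots> < ereal e" using e by simp
    finally show ?thesis
      by (intro bexI[of _ "\<lambda>t. f t - g t"] smooth_paths_diff f(1) g(1))
  qed
  then show ?thesis using v w unfolding path_space_def by simp
qed

text \<open>\<open>path_dist\<close> passes through \<open>real_of_ereal\<close>, which sends
  infinity to 0. The equivalence holds because differences of elements of the space have finite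
  norm.\<close>

lemma path_dist_le_iff:
  assumes h: "0 < h" "h < 1" and vw: "v \<in> path_space h" "w \<in> path_space h" and c: "0 \<le> c"
  shows "path_dist h v w \<le> c \<longleftrightarrow> holder_le h c (\<lambda>t. v t - w t)"
proof -
  have "holder_norm h (\<lambda>t. v t - w t) < \<infinity>"
    unfolding holder_norm_finite_iff by (rule path_space_finite[OF h path_space_diff[OF vw]])
  then obtain r where r: "holder_norm h (\<lambda>t. v t - w t) = ereal r"
    using holder_norm_nonneg[of h "\<lambda>t. v t - w t"] by (cases "holder_norm h (\<lambda>t. v t - w t)") auto
  then show ?thesis using holder_norm_le_iff[OF c, of h "\<lambda>t. v t - w t"] by (simp add: path_dist_def)
qed

lemma path_dist_nonneg: "0 \<le> path_dist h v w"
  unfolding path_dist_def using holder_norm_nonneg by (rule real_of_ereal_pos)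

lemma path_dist_bound:
  assumes h: "0 < h" "h < 1" and vw: "v \<in> path_space h" "w \<in> path_space h" and t: "t \<le> 0"
  shows "norm (v t - w t) \<le> path_dist h v w * holder_weight h 0 t"
proof -
  have "holder_le h (path_dist h v w) (\<lambda>t. v t - w t)"
    using path_dist_le_iff[OF h vw path_dist_nonneg] by blast
  then have "norm ((v t - w t) - (v 0 - w 0)) \<le> path_dist h v w * holder_weight h 0 t"
    unfolding holder_le_def using t by blast
  moreover have "v 0 = 0" "w 0 = 0" using vw by (auto simp: path_space_def)
  ultimately show ?thesis by simp
qed

text \<open>\<open>path_topology\<close> is defined through \<open>Metric_space.mtopology\<close>,
  whose theory becomes available only with these axioms. On the positive half-line separation holds
  because all representatives vanish there.\<close>

lemma Metric_space_path:
  assumes h: "0 < h" "h < 1"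
  shows "Metric_space (path_space h) (path_dist h :: ('n::finite) path \<Rightarrow> 'n path \<Rightarrow> real)"
proof
  fix v w u :: "'n path"
  show "0 \<le> path_dist h v w" by (rule path_dist_nonneg)
  show "path_dist h v w = path_dist h w v"
    unfolding path_dist_def holder_norm_def
    by (simp add: norm_minus_commute algebra_simps)
  show "path_dist h v w = 0 \<longleftrightarrow> v = w" if vw: "v \<in> path_space h" "w \<in> path_space h"
  proof
    assume "path_dist h v w = 0"
    then have "v t = w t" if "t \<le> 0" for t
      using path_dist_bound[OF h vw that] by simp
    moreover have "v t = w t" if "t > 0" for t using vw that by (simp add: path_space_def)
    ultimately show "v = w" by (metis linorder_not_le ext)
  next
    assume "v = w"
    then have "path_dist h v w \<le> 0"
      using path_dist_le_iff[OF h vw order_refl] by (simp add: holder_le_def)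
    then show "path_dist h v w = 0" using path_dist_nonneg[of h v w] by simp
  qed
  show "path_dist h v u \<le> path_dist h v w + path_dist h w u"
    if vw: "v \<in> path_space h" "w \<in> path_space h" "u \<in> path_space h"
  proof -
    have "holder_le h (path_dist h v w) (\<lambda>t. v t - w t)"
      using path_dist_le_iff[OF h vw(1,2) path_dist_nonneg] by blast
    moreover have "holder_le h (path_dist h w u) (\<lambda>t. w t - u t)"
      using path_dist_le_iff[OF h vw(2,3) path_dist_nonneg] by blast
    ultimately have "holder_le h (path_dist h v w + path_dist h w u) (\<lambda>t. (v t - w t) + (w t - u t))"
      by (rule holder_le_add)
    then show ?thesis
      by (subst path_dist_le_iff[OF h vw(1,3)]) (auto simp: path_dist_nonneg add_nonneg_nonneg)
  qed
qed

lemma topspace_path_topology: "0 < h \<Longrightarrow> h < 1 \<Longrightarrow> topspace (path_topology h) = path_space h"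
  unfolding path_topology_def by (rule Metric_space.topspace_mtopology[OF Metric_space_path])

text \<open>Smooth paths are dense by the definition of the space, so a countable net for them at
  scale e / 3 serves all paths.\<close>

lemma path_space_net:
  fixes e :: real
  assumes h: "0 < h" "h < 1" and e: "0 < e"
  shows "\<exists>Q\<subseteq>path_space h. countable Q \<and> 
    (\<forall>w\<in>path_space h. \<exists>v\<in>Q. path_dist h w (v :: ('n::finite) path) < e)"
proof -
  obtain Q :: "'n path set" where Q: "Q \<subseteq> smooth_paths" "countable Q"
    "\<And>w. w \<in> smooth_paths \<Longrightarrow> \<exists>v\<in>Q. holder_norm h (\<lambda>t. w t - v t) < ereal (e / 3)"
    using smooth_paths_net[OF h, of "e / 3"] e by auto
  have "\<exists>v\<in>Q. path_dist h w v < e" if w: "w \<in> path_space h" for w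
  proof -
    obtain f where f: "f \<in> smooth_paths" "holder_norm h (\<lambda>t. w t - f t) < ereal (e/3)"
      using w e unfolding path_space_def by (auto dest: spec[of _ "e/3"])
    obtain v where v: "v \<in> Q" "holder_norm h (\<lambda>t. f t - v t) < ereal (e / 3)" using Q(3)[OF f(1)] by blast
    have "holder_le h (e/3) (\<lambda>t. w t - f t)" "holder_le h (e/3) (\<lambda>t. f t - v t)"
      using f(2) v(2) e by (simp_all flip: holder_norm_le_iff)
    then have "holder_le h (e/3 + e/3) (\<lambda>t. (w t - f t) + (f t - v t))" by (rule holder_le_add)
    moreover have "v \<in> path_space h" using v(1) Q(1) smooth_subset_path_space by blast
    ultimately have "path_dist h w v \<le> e/3 + e/3"
      using e w by (subst path_dist_le_iff[OF h]) auto
    then show ?thesis using v(1) e by (intro bexI[of _ v]) auto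
  qed
  then show ?thesis using Q smooth_subset_path_space by blast
qed

section \<open>Borel sets of paths and evaluations\<close>

lemma tendsto_floor_ratio: "(\<lambda>n. real_of_int \<lfloor>real (Suc n) * t\<rfloor> / real (Suc n)) \<longlonglongrightarrow> t"
proof (rule tendsto_sandwich)
  show "\<forall>\<^sub>F n in sequentially. t - 1 / real (Suc n) \<le> real_of_int \<lfloor>real (Suc n) * t\<rfloor> / real (Suc n)"
  proof (intro always_eventually allI)
    fix n
    have "(t - 1 / real (Suc n)) * real (Suc n) = real (Suc n) * t - 1" by (simp add: field_simps)
    also have "\<dots> \<le> real_of_int \<lfloor>real (Suc n) * t\<rfloor>" by linarith
    finally show "t - 1 / real (Suc n) \<le> real_of_int \<lfloor>real (Suc n) * t\<rfloor> / real (Suc n)"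
      by (simp only: pos_le_divide_eq of_nat_0_less_iff zero_less_Suc)
  qed
  show "\<forall>\<^sub>F n in sequentially. real_of_int \<lfloor>real (Suc n) * t\<rfloor> / real (Suc n) \<le> t"
    by (intro always_eventually allI)
       (simp only: pos_divide_le_eq of_nat_0_less_iff zero_less_Suc mult.commute[of t] of_int_floor_le)
  show "(\<lambda>n. t - 1 / real (Suc n)) \<longlonglongrightarrow> t"
    using tendsto_diff[OF tendsto_const[of t] LIMSEQ_inverse_real_of_nat] by (simp add: inverse_eq_divide)
qed simp

lemma holder_le_continuous:
  assumes h: "h < 1" and w: "holder_le h c w"
  shows "continuous_on {..0} w"
  unfolding continuous_on
proof
  fix s :: real assume s: "s \<in> {..0}"
  have "((\<lambda>t. c * holder_weight h s t) \<longlongrightarrow> c * (sqrt (1 + \<bar>s\<bar> + \<bar>s\<bar>) * 0)) (at s within {..0})"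
    unfolding holder_weight_def using h
    by (intro tendsto_intros tendsto_zero_powrI[of _ _ _ "(1 - h) / 2"])
       (auto intro!: tendsto_eq_intros)
  then have lim: "((\<lambda>t. c * holder_weight h s t) \<longlongrightarrow> 0) (at s within {..0})" by simp
  have "((\<lambda>t. w t - w s) \<longlongrightarrow> 0) (at s within {..0})"
  proof (rule Lim_null_comparison[OF _ lim])
    show "\<forall>\<^sub>F t in at s within {..0}. norm (w t - w s) \<le> c * holder_weight h s t"
      unfolding eventually_at_filter using w s by (intro always_eventually) (auto simp: holder_le_def)
  qed
  then show "(w \<longlongrightarrow> w s) (at s within {..0})" by (rule LIM_zero_cancel)
qed

text \<open>Continuity extends the bound from rational times to all times. Membership in a closed
  ball thus becomes a countable conjunction of conditions on evaluations.\<close>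

lemma holder_le_rational:
  assumes w: "continuous_on {..0} w" and h: "h < 1"
    and le: "\<And>s t. s \<in> \<rat> \<Longrightarrow> t \<in> \<rat> \<Longrightarrow> s \<le> 0 \<Longrightarrow> t \<le> 0 \<Longrightarrow> norm (w t - w s) \<le> c * holder_weight h s t"
  shows "holder_le h c w"
  unfolding holder_le_def
proof (intro allI impI)
  fix s t :: real assume st: "s \<le> 0" "t \<le> 0"
  \<comment> \<open>Rounding down keeps the approximating rationals nonpositive, where the
    continuity of \<open>w\<close> is available.\<close>
  define q where "q r n = real_of_int \<lfloor>real (Suc n) * r\<rfloor> / real (Suc n)" for r :: real and n
  have q: "q r n \<in> \<rat>" for r n unfolding q_def by (intro Rats_divide) auto
  have q0: "q r n \<le> 0" if "r \<le> 0" for r n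
  proof -
    have "real (Suc n) * r \<le> 0" using that by (intro mult_nonneg_nonpos) auto
    then have "real_of_int \<lfloor>real (Suc n) * r\<rfloor> \<le> 0" by linarith
    then show ?thesis unfolding q_def by (intro divide_nonpos_nonneg) auto
  qed
  have lim: "q r \<longlonglongrightarrow> r" for r unfolding q_def by (rule tendsto_floor_ratio)
  have wlim: "(\<lambda>n. w (q r n)) \<longlonglongrightarrow> w r" if "r \<le> 0" for r
    using that q0 by (intro continuous_on_tendsto_compose[OF w lim]) auto
  \<comment> \<open>For s = t both approximating sequences coincide and the weight is constantly 0;
    otherwise the base of the power has a nonzero limit, as its limit rule requires.\<close>
  have "(\<lambda>n. holder_weight h (q s n) (q t n)) \<longlonglongrightarrow> holder_weight h s t"
  proof (cases "s = t")
    case True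
    then show ?thesis by (simp add: holder_weight_def)
  next
    case False
    then show ?thesis unfolding holder_weight_def by (intro tendsto_intros lim) auto
  qed
  then show "norm (w t - w s) \<le> c * holder_weight h s t"
    using q q0 st le by (intro LIMSEQ_le[OF tendsto_norm[OF tendsto_diff[OF wlim wlim]] tendsto_mult_left]) auto
qed

text \<open>Cylinders over a single time. The family is not stable under intersection, which the
  zero-one law has to make up for.\<close>

definition evaluations :: "real \<Rightarrow> ('n::finite) path set set" where
  "evaluations h = {{w \<in> path_space h. w t \<in> A} | t A. t \<le> 0 \<and> A \<in> sets borel}"

lemma evaluations_Pow: "evaluations h \<subseteq> Pow (path_space h)"
  by (auto simp: evaluations_def)

text \<open>A closed ball is given by conditions at rational times. By separability, an open set is
  the union of the closed balls of radius 1 / (k + 1) around points of the k-th net that it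
  contains, and there are countably many of these.\<close>

lemma openin_path_topology_evaluations:
  fixes U :: "('n::finite) path set"
  assumes h: "0 < h" "h < 1" and U: "openin (path_topology h) U"
  shows "U \<in> sigma_sets (path_space h) (evaluations h)"
proof -
  interpret Metric_space "path_space h" "path_dist h :: 'n path \<Rightarrow> 'n path \<Rightarrow> real"
    by (rule Metric_space_path[OF h])
  define M where "M = sigma (path_space h) (evaluations h :: 'n path set set)"
  have sp[simp]: "space M = path_space h" and sets: "sets M = sigma_sets (path_space h) (evaluations h)"
    unfolding M_def by (simp_all add: space_measure_of[OF evaluations_Pow] sets_measure_of[OF evaluations_Pow])
  have ev[measurable]: "(\<lambda>w. w t) \<in> borel_measurable M" if "t \<le> 0" for t
    using that by (intro measurableI) (auto simp: sets evaluations_def vimage_def Int_def conj_commute)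
  have ball: "{w \<in> path_space h. path_dist h v w \<le> r} \<in> sets M" if v: "v \<in> path_space h" and r: "0 \<le> r" for v r
  proof -
    define C where "C = \<rat> \<inter> {..0::real}"
    have C: "countable C" unfolding C_def using countable_rat by blast
    have eq: "path_dist h v w \<le> r \<longleftrightarrow> 
        (\<forall>s\<in>C. \<forall>t\<in>C. norm ((v t - w t) - (v s - w s)) \<le> r * holder_weight h s t)"
      if w: "w \<in> path_space h" for w
    proof
      assume "path_dist h v w \<le> r"
      then show "\<forall>s\<in>C. \<forall>t\<in>C. norm ((v t - w t) - (v s - w s)) \<le> r * holder_weight h s t"
        unfolding path_dist_le_iff[OF h v w r] by (simp add: holder_le_def C_def)
    next
      assume *: "\<forall>s\<in>C. \<forall>t\<in>C. norm ((v t - w t) - (v s - w s)) \<le> r * holder_weight h s t"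
      obtain c where "holder_le h c (\<lambda>t. v t - w t)"
        using path_space_finite[OF h path_space_diff[OF v w]] by blast
      then have "continuous_on {..0} (\<lambda>t. v t - w t)" using holder_le_continuous h by blast
      then have "holder_le h r (\<lambda>t. v t - w t)"
        using * h by (intro holder_le_rational) (auto simp: C_def)
      then show "path_dist h v w \<le> r" unfolding path_dist_le_iff[OF h v w r] .
    qed
    have "{w \<in> space M. \<forall>s\<in>C. \<forall>t\<in>C. norm ((v t - w t) - (v s - w s)) \<le> r * holder_weight h s t} \<in> sets M"
    proof (intro sets.sets_Collect_countable_All'[OF _ C])
      fix s t assume "s \<in> C" "t \<in> C"
      then have [measurable]: "(\<lambda>w. w s) \<in> borel_measurable M" "(\<lambda>w. w t) \<in> borel_measurable M"
        by (auto simp: C_def)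
      show "{w \<in> space M. norm ((v t - w t) - (v s - w s)) \<le> r * holder_weight h s t} \<in> sets M"
        by measurable
    qed
    also have "{w \<in> space M. \<forall>s\<in>C. \<forall>t\<in>C. norm ((v t - w t) - (v s - w s)) \<le> r * holder_weight h s t} = 
      {w \<in> path_space h. path_dist h v w \<le> r}" using eq by auto
    finally show ?thesis .
  qed
  have "\<forall>k. \<exists>Q\<subseteq>path_space h. countable Q \<and> 
      (\<forall>w\<in>path_space h. \<exists>v\<in>Q. path_dist h w (v :: 'n path) < 1 / real (Suc k))"
    by (intro allI path_space_net[OF h]) simp
  then obtain Q :: "nat \<Rightarrow> 'n path set" where Q: "\<And>k. Q k \<subseteq> path_space h" "\<And>k. countable (Q k)"
    "\<And>k w. w \<in> path_space h \<Longrightarrow> \<exists>v\<in>Q k. path_dist h w v < 1 / real (Suc k)"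
    by metis
  define B where "B v k = {w \<in> path_space h. path_dist h v w \<le> 1 / real (Suc k)}" for v :: "'n path" and k
  define I where "I = {(k, v). v \<in> Q k \<and> B v k \<subseteq> U}"
  have "countable I"
    by (rule countable_subset[of _ "SIGMA k:UNIV. Q k"]) (auto simp: I_def Q(2))
  moreover have "B v k \<in> sets M" if "(k, v) \<in> I" for k v
    using that Q(1)[of k] ball[of v] unfolding B_def I_def by auto
  ultimately have "(\<Union>(k, v)\<in>I. B v k) \<in> sets M" by (intro sets.countable_UN') auto
  moreover have "(\<Union>(k, v)\<in>I. B v k) = U"
  proof
    show "(\<Union>(k, v)\<in>I. B v k) \<subseteq> U" by (auto simp: I_def)
    show "U \<subseteq> (\<Union>(k, v)\<in>I. B v k)"
    proof
      fix w assume w: "w \<in> U"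
      obtain r where r: "r > 0" "mball w r \<subseteq> U" and wp: "w \<in> path_space h"
        using U w unfolding path_topology_def openin_mtopology by blast
      \<comment> \<open>Half of r leaves room for two distances: from \<open>w\<close> to the net
        point and from there to any point of its ball.\<close>
      obtain k where k: "1 / real (Suc k) < r / 2" using r(1) nat_approx_posE[of "r / 2"] by auto
      obtain v where v: "v \<in> Q k" "path_dist h w v < 1 / real (Suc k)" using Q(3)[OF wp] by blast
      have vp: "v \<in> path_space h" using v Q(1) by blast
      have "B v k \<subseteq> mball w r"
      proof
        fix u assume "u \<in> B v k"
        then show "u \<in> mball w r"
          using triangle[OF wp vp, of u] v(2) k wp by (auto simp: B_def)
      qed
      then have "(k, v) \<in> I" using r v by (auto simp: I_def)
      moreover have "w \<in> B v k" using v(2) wp by (simp add: B_def commute)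
      ultimately show "w \<in> (\<Union>(k, v)\<in>I. B v k)" by blast
    qed
  qed
  ultimately show ?thesis by (simp add: sets)
qed

lemma sets_path_borel: "0 < h \<Longrightarrow> h < 1 \<Longrightarrow> 
    sets (path_borel h) = sigma_sets (path_space h) {U. openin (path_topology h) U}"
  unfolding path_borel_def using openin_subset[of "path_topology h"] topspace_path_topology[of h]
  by (intro sets_measure_of) auto

lemma space_path_borel: "0 < h \<Longrightarrow> h < 1 \<Longrightarrow> space (path_borel h) = path_space h"
  unfolding path_borel_def using openin_subset[of "path_topology h"] topspace_path_topology[of h]
  by (intro space_measure_of) auto

lemma sets_path_borel_evaluations:
  assumes h: "0 < h" "h < 1"
  shows "sets (path_borel h) \<subseteq> sigma_sets (path_space h) (evaluations h)"
  unfolding sets_path_borel[OF h] by (rule sigma_sets_mono) (use openin_path_topology_evaluations[OF h] in auto)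

lemma continuous_map_path_measurable:
  fixes f :: "('n::finite) path \<Rightarrow> ('m::finite) path"
  assumes h: "0 < h" "h < 1" and k: "0 < k" "k < 1"
    and f: "continuous_map (path_topology h) (path_topology k) f"
  shows "f \<in> path_borel h \<rightarrow>\<^sub>M path_borel k"
  unfolding path_borel_def[of k]
proof (rule measurable_measure_of)
  show "{U. openin (path_topology k) U} \<subseteq> Pow (path_space k)"
    using openin_subset[of "path_topology k"] topspace_path_topology[OF k] by auto
  show "f \<in> space (path_borel h) \<rightarrow> path_space k"
    using continuous_map_funspace[OF f] by (simp add: space_path_borel h k topspace_path_topology)
  fix U :: "'m path set" assume "U \<in> {U. openin (path_topology k) U}"
  then have "openin (path_topology h) {x \<in> topspace (path_topology h). f x \<in> U}"
    using f by (auto simp: continuous_map_def)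
  then show "f -` U \<inter> space (path_borel h) \<in> sets (path_borel h)"
    by (auto simp: sets_path_borel h space_path_borel topspace_path_topology vimage_def Int_def conj_commute)
qed

section \<open>Solutions of the integral equation\<close>

text \<open>The squared norm is differentiable even where \<open>u\<close> vanishes, and its product
  with exp (- 2 * c * t) is nonincreasing. The sign of \<open>c\<close> is free, so one estimate
  covers both growth at rate C3 and contraction at rate C4.\<close>

lemma gronwall_inner:
  fixes u v :: "real \<Rightarrow> 'a::real_inner"
  assumes d: "0 \<le> d" and cont: "continuous_on {0..d} u"
    and der: "\<And>t. 0 < t \<Longrightarrow> t < d \<Longrightarrow> (u has_vector_derivative v t) (at t)"
    and le: "\<And>t. 0 < t \<Longrightarrow> t < d \<Longrightarrow> v t \<bullet> u t \<le> c * (norm (u t))\<^sup>2"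
  shows "norm (u d) \<le> norm (u 0) * exp (c * d)"
proof -
  define q where "q t = (u t \<bullet> u t) * exp (- 2 * c * t)" for t
  have "q d \<le> q 0"
  proof (rule DERIV_nonpos_imp_decreasing_open[OF d])
    show "continuous_on {0..d} q" unfolding q_def by (intro continuous_intros cont)
    fix t assume t: "0 < t" "t < d"
    have "(u has_derivative (\<lambda>h. h *\<^sub>R v t)) (at t)"
      using der[OF t] by (simp add: has_vector_derivative_def)
    then have "((\<lambda>t. u t \<bullet> u t) has_derivative (\<lambda>h. u t \<bullet> (h *\<^sub>R v t) + (h *\<^sub>R v t) \<bullet> u t)) (at t)"
      by (intro has_derivative_inner)
    then have "((\<lambda>t. u t \<bullet> u t) has_real_derivative 2 * (v t \<bullet> u t)) (at t)"
      unfolding has_field_derivative_def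
      by (rule has_derivative_eq_rhs) (auto simp: inner_commute algebra_simps)
    then have "(q has_real_derivative (2 * (v t \<bullet> u t) * exp (- 2 * c * t) + 
        exp (- 2 * c * t) * (- 2 * c) * (u t \<bullet> u t))) (at t)"
      unfolding q_def by (auto intro!: derivative_eq_intros)
    moreover have "2 * (v t \<bullet> u t) * exp (- 2 * c * t) + exp (- 2 * c * t) * (- 2 * c) * (u t \<bullet> u t)
        = 2 * exp (- 2 * c * t) * (v t \<bullet> u t - c * (norm (u t))\<^sup>2)"
      by (simp add: power2_norm_eq_inner algebra_simps)
    moreover have "\<dots> \<le> 0" using le[OF t] by (intro mult_nonneg_nonpos) auto
    ultimately show "\<exists>y. (q has_real_derivative y) (at t) \<and> y \<le> 0" by metis
  qed
  then have "(norm (u d))\<^sup>2 * exp (- 2 * c * d) \<le> (norm (u 0))\<^sup>2"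
    by (simp add: q_def power2_norm_eq_inner)
  then have "(norm (u d))\<^sup>2 * exp (- 2 * c * d) * exp (2 * c * d) \<le> (norm (u 0))\<^sup>2 * exp (2 * c * d)"
    by (rule mult_right_mono) simp
  moreover have "(norm (u d))\<^sup>2 * exp (- 2 * c * d) * exp (2 * c * d) = (norm (u d))\<^sup>2"
    by (simp add: mult.assoc flip: exp_add)
  moreover have "exp (2 * c * d) = (exp (c * d))\<^sup>2" by (simp add: exp_double mult.assoc)
  ultimately have "(norm (u d))\<^sup>2 \<le> (norm (u 0) * exp (c * d))\<^sup>2"
    by (simp only: power_mult_distrib)
  then show ?thesis by (rule power2_le_imp_le) simp
qed

text \<open>The noise is an arbitrary function \<open>B\<close>, so a solution need not be
  differentiable; differences of two solutions with the same \<open>B\<close> are, for continuous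
  \<open>f\<close>.\<close>

definition integral_solution :: "('a::euclidean_space \<Rightarrow> 'a) \<Rightarrow> (real \<Rightarrow> 'a) \<Rightarrow> 'a \<Rightarrow> real \<Rightarrow> (real \<Rightarrow> 'a) \<Rightarrow> bool" where
  "integral_solution f B x d y \<longleftrightarrow> continuous_on {0..d} y \<and>
     (\<forall>t\<in>{0..d}. y t = x + integral {0..t} (\<lambda>s. f (y s)) + B t)"

text \<open>The noise cancels in the difference, which therefore has a classical derivative. The
  one-sided bound is asked only along the two trajectories, so it may depend on where they run.
  Equal initial values yield uniqueness.\<close>

lemma solution_difference:
  assumes d: "0 \<le> d" and f: "continuous_on UNIV f"
    and y: "integral_solution f B x d y" and z: "integral_solution f B x' d z"
    and le: "\<And>t. 0 < t \<Longrightarrow> t < d \<Longrightarrow> (f (y t) - f (z t)) \<bullet> (y t - z t) \<le> c * (norm (y t - z t))\<^sup>2"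
  shows "norm (y d - z d) \<le> norm (x - x') * exp (c * d)"
proof -
  have cy: "continuous_on {0..d} y" and cz: "continuous_on {0..d} z"
    using y z by (auto simp: integral_solution_def)
  have fy: "continuous_on {0..d} (\<lambda>s. f (y s))" and fz: "continuous_on {0..d} (\<lambda>s. f (z s))"
    using continuous_on_compose2[OF f cy] continuous_on_compose2[OF f cz] by auto
  have "norm (y d - z d) \<le> norm (y 0 - z 0) * exp (c * d)"
  proof (rule gronwall_inner[OF d _ _ le])
    show "continuous_on {0..d} (\<lambda>t. y t - z t)" by (intro continuous_intros cy cz)
    fix t assume t: "0 < t" "t < d"
    define w where "w t = (x - x') + (integral {0..t} (\<lambda>s. f (y s)) - integral {0..t} (\<lambda>s. f (z s)))" for t
    have "(w has_vector_derivative (0 + (f (y t) - f (z t)))) (at t within {0..d})"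
      unfolding w_def using t
      by (intro has_vector_derivative_add has_vector_derivative_const has_vector_derivative_diff
          integral_has_vector_derivative fy fz) auto
    then have "(w has_vector_derivative (f (y t) - f (z t))) (at t)"
      using t at_within_interior[of t "{0..d}"] by simp
    then show "((\<lambda>t. y t - z t) has_vector_derivative (f (y t) - f (z t))) (at t)"
    proof (rule has_vector_derivative_transform_within_open[of _ _ _ "{0<..<d}"])
      show "w s = y s - z s" if "s \<in> {0<..<d}" for s
        using y z that by (simp add: w_def integral_solution_def)
    qed (use t in auto)
  qed
  moreover have "y 0 - z 0 = x - x'"
    using y z d unfolding integral_solution_def by (auto dest!: bspec[of _ _ 0])
  ultimately show ?thesis by simp
qed

section \<open>Measurability of solutions through Euler schemes\<close>

primrec euler :: "('a::real_vector \<Rightarrow> 'a) \<Rightarrow> (real \<Rightarrow> 'a) \<Rightarrow> 'a \<Rightarrow> real \<Rightarrow> nat \<Rightarrow> 'a" where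
  "euler f B x h 0 = x + B 0"
| "euler f B x h (Suc k) = euler f B x h k + h *\<^sub>R f (euler f B x h k) + (B (real (Suc k) * h) - B (real k * h))"

text \<open>The start x + B 0 and the exact noise increments leave the drift as the only source of
  error. An error r becomes at most (1 + h * L) * r + h * L * e after one step, where
  \<open>e\<close> bounds the oscillation of \<open>y\<close> over a step; starting from 0, the
  stated bound solves this recursion with equality.\<close>

lemma euler_error:
  assumes L: "0 \<le> L" "\<And>a b. norm (f a - f b) \<le> L * norm (a - b)" and h: "0 < h" and e: "0 \<le> e"
    and y: "integral_solution f B x d y"
    and osc: "\<And>s t. s \<in> {0..d} \<Longrightarrow> t \<in> {0..d} \<Longrightarrow> \<bar>s - t\<bar> \<le> h \<Longrightarrow> norm (y s - y t) \<le> e"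
    and k: "real k * h \<le> d"
  shows "norm (y (real k * h) - euler f B x h k) \<le> ((1 + h * L) ^ k - 1) * e"
  using k
proof (induction k)
  case 0
  then have "y 0 = x + B 0" using y h by (simp add: integral_solution_def)
  then show ?case by simp
next
  case (Suc k)
  define a b where "a = real k * h" and "b = real (Suc k) * h"
  have ab: "0 \<le> a" "a \<le> b" "b = a + h" "b \<le> d" using h Suc.prems by (auto simp: a_def b_def algebra_simps)
  define E where "E = euler f B x h k"
  have IH: "norm (y a - E) \<le> ((1 + h * L) ^ k - 1) * e"
    using Suc.IH ab(2,4) by (simp add: a_def E_def)
  have cf: "continuous_on UNIV f"
  proof (rule lipschitz_on_continuous_on)
    show "L-lipschitz_on UNIV f" using L by (intro lipschitz_onI) (auto simp: dist_norm)
  qed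
  have fy: "continuous_on {0..d} (\<lambda>s. f (y s))"
    using y by (intro continuous_on_compose2[OF cf]) (auto simp: integral_solution_def)
  have int: "(\<lambda>s. f (y s)) integrable_on {0..b}"
    using ab by (intro integrable_continuous_real continuous_on_subset[OF fy]) auto
  have "integral {0..a} (\<lambda>s. f (y s)) + integral {a..b} (\<lambda>s. f (y s)) = integral {0..b} (\<lambda>s. f (y s))"
    using ab int by (intro Henstock_Kurzweil_Integration.integral_combine) auto
  moreover have "y a = x + integral {0..a} (\<lambda>s. f (y s)) + B a" "y b = x + integral {0..b} (\<lambda>s. f (y s)) + B b"
    using y ab unfolding integral_solution_def by auto
  ultimately have step: "y b = y a + integral {a..b} (\<lambda>s. f (y s)) + (B b - B a)"
    by (simp add: algebra_simps)
  have fyab: "continuous_on {a..b} (\<lambda>s. f (y s))" using ab by (intro continuous_on_subset[OF fy]) auto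
  \<comment> \<open>During the step \<open>y\<close> stays within e of \<open>y a\<close>, hence
    within e + norm (y a - E) of the point \<open>E\<close> at which the scheme freezes the
    drift.\<close>
  have "norm (integral {a..b} (\<lambda>s. f (y s) - f E)) \<le> (L * (e + norm (y a - E))) * (b - a)"
  proof (rule integral_bound)
    show "continuous_on {a..b} (\<lambda>s. f (y s) - f E)" by (intro continuous_intros fyab)
    fix s assume s: "s \<in> {a..b}"
    have "norm (y s - E) \<le> norm (y s - y a) + norm (y a - E)" by norm
    also have "norm (y s - y a) \<le> e" using s ab by (intro osc) auto
    finally have "L * norm (y s - E) \<le> L * (e + norm (y a - E))" using L(1) by (intro mult_left_mono) auto
    then show "norm (f (y s) - f E) \<le> L * (e + norm (y a - E))" using L(2)[of "y s" E] by linarith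
  qed (use ab in auto)
  moreover have "integral {a..b} (\<lambda>s. f (y s) - f E) = integral {a..b} (\<lambda>s. f (y s)) - h *\<^sub>R f E"
    using ab Henstock_Kurzweil_Integration.integral_diff[OF integrable_continuous_real[OF fyab] integrable_const_ivl[of "f E"]]
    by simp
  ultimately have *: "norm (integral {a..b} (\<lambda>s. f (y s)) - h *\<^sub>R f E) \<le> L * (e + norm (y a - E)) * h"
    using ab(3) by simp
  have "norm (y b - euler f B x h (Suc k)) = norm ((y a - E) + (integral {a..b} (\<lambda>s. f (y s)) - h *\<^sub>R f E))"
  proof -
    have "euler f B x h (Suc k) = E + h *\<^sub>R f E + (B b - B a)"
      by (simp only: euler.simps E_def a_def b_def)
    then show ?thesis unfolding step by (simp add: algebra_simps)
  qed
  also have "\<dots> \<le> norm (y a - E) + L * (e + norm (y a - E)) * h"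
    using norm_triangle_ineq[of "y a - E"] * by (meson add_left_mono order_trans)
  also have "\<dots> = norm (y a - E) * (1 + h * L) + h * L * e" by (simp add: algebra_simps)
  also have "\<dots> \<le> ((1 + h * L) ^ k - 1) * e * (1 + h * L) + h * L * e"
    using IH h L(1) by (intro add_right_mono mult_right_mono) auto
  also have "\<dots> = ((1 + h * L) ^ Suc k - 1) * e" by (simp add: algebra_simps)
  finally show ?case by (simp only: b_def)
qed

lemma euler_tendsto:
  assumes L: "0 \<le> L" "\<And>a b. norm (f a - f b) \<le> L * norm (a - b)" and d: "0 < d"
    and y: "integral_solution f B x d y"
  shows "(\<lambda>n. euler f B x (d / real (Suc n)) (Suc n)) \<longlonglongrightarrow> y d"
proof (rule metric_LIMSEQ_I)
  fix r :: real assume r: "0 < r"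
  \<comment> \<open>The powers (1 + h * L) ^ n with n * h = d are at most exp (d * L) for every step
    size; this choice brings the final error down to r / 2.\<close>
  define e where "e = r / (2 * exp (d * L))"
  have e: "0 < e" using r by (simp add: e_def)
  have "uniformly_continuous_on {0..d} y"
    using y by (intro compact_uniformly_continuous) (auto simp: integral_solution_def)
  then obtain g where g: "g > 0" "\<And>s t. s \<in> {0..d} \<Longrightarrow> t \<in> {0..d} \<Longrightarrow> dist s t < g \<Longrightarrow> dist (y s) (y t) < e"
    using e unfolding uniformly_continuous_on_def by metis
  obtain M :: nat where M: "d / g < real M" using reals_Archimedean2 by blast
  show "\<exists>no. \<forall>n\<ge>no. dist (euler f B x (d / real (Suc n)) (Suc n)) (y d) < r"
  proof (intro exI allI impI)
    fix n assume n: "n \<ge> M"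
    define h where "h = d / real (Suc n)"
    have h: "0 < h" and hd: "real (Suc n) * h = d" using d by (simp_all add: h_def)
    have "d / g < real (Suc n)" using M n by linarith
    then have hg: "h < g" using g(1) d by (simp add: h_def field_simps)
    have "norm (y (real (Suc n) * h) - euler f B x h (Suc n)) \<le> ((1 + h * L) ^ Suc n - 1) * e"
    proof (rule euler_error[OF L h _ y])
      show "norm (y s - y t) \<le> e" if "s \<in> {0..d}" "t \<in> {0..d}" "\<bar>s - t\<bar> \<le> h" for s t
        using g(2)[OF that(1,2)] that(3) hg by (simp add: dist_norm)
    qed (use e hd in auto)
    also have "\<dots> \<le> exp (h * L) ^ Suc n * e"
    proof (rule mult_right_mono)
      have "(1 + h * L) ^ Suc n \<le> exp (h * L) ^ Suc n"
        using exp_ge_add_one_self[of "h * L"] h L(1) by (intro power_mono) (auto simp: add_nonneg_nonneg)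
      then show "(1 + h * L) ^ Suc n - 1 \<le> exp (h * L) ^ Suc n" by linarith
    qed (use e in auto)
    also have "exp (h * L) ^ Suc n = exp (d * L)"
      unfolding exp_of_nat_mult[symmetric] hd[symmetric] by (simp add: mult_ac)
    also have "exp (d * L) * e < r" using r by (simp add: e_def)
    finally show "dist (euler f B x (d / real (Suc n)) (Suc n)) (y d) < r"
      unfolding h_def[symmetric] hd by (simp add: dist_norm norm_minus_commute)
  qed
qed

text \<open>The Euler scheme converges once \<open>f\<close> is cut off outside a ball that contains the trajectory; the
  radius depends on \<open>w\<close> and is sent to infinity last. For small radii, \<open>lim\<close> below may be a junk value.\<close>

lemma integral_solution_measurable:
  fixes f :: "'a::euclidean_space \<Rightarrow> 'a"
  assumes lip: "\<And>K. \<exists>L. \<forall>a\<in>cball 0 K. \<forall>b\<in>cball 0 K. norm (f a - f b) \<le> L * norm (a - b)"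
    and X: "X \<in> borel_measurable M" and B: "\<And>t. 0 \<le> t \<Longrightarrow> (\<lambda>w. B w t) \<in> borel_measurable M"
    and y: "\<And>w. w \<in> space M \<Longrightarrow> integral_solution f (B w) (X w) d (Y w)" and d: "0 < d"
  shows "(\<lambda>w. Y w d) \<in> borel_measurable M"
proof -
  \<comment> \<open>Projection onto a ball is 1-Lipschitz, so each \<open>g k\<close> is globally
    Lipschitz, and it equals \<open>f\<close> on the ball of radius k.\<close>
  define g where "g k a = f (closest_point (cball 0 (real k)) a)" for k :: nat and a
  have cp: "closest_point (cball 0 (real k)) a \<in> cball 0 (real k)" for k and a :: 'a
    by (rule closest_point_in_set) auto
  have "\<exists>L\<ge>0. \<forall>a b. norm (g k a - g k b) \<le> L * norm (a - b)" for k
  proof -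
    obtain L where L: "\<And>a b. a \<in> cball 0 (real k) \<Longrightarrow> b \<in> cball 0 (real k) \<Longrightarrow> norm (f a - f b) \<le> L * norm (a - b)"
      using lip by meson
    have "norm (g k a - g k b) \<le> \<bar>L\<bar> * norm (a - b)" for a b
    proof -
      define a' b' where "a' = closest_point (cball 0 (real k)) a" and "b' = closest_point (cball 0 (real k)) b"
      have "norm (g k a - g k b) \<le> L * norm (a' - b')" unfolding g_def a'_def b'_def by (intro L cp)
      also have "\<dots> \<le> \<bar>L\<bar> * norm (a' - b')" by (intro mult_right_mono) auto
      also have "norm (a' - b') \<le> norm (a - b)"
        unfolding a'_def b'_def dist_norm[symmetric] by (rule closest_point_lipschitz) auto
      finally show ?thesis by (simp add: mult_left_mono)
    qed
    then show ?thesis by (intro exI[of _ "\<bar>L\<bar>"]) auto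
  qed
  then obtain L where L: "\<And>k. 0 \<le> L k" "\<And>k a b. norm (g k a - g k b) \<le> L k * norm (a - b)"
    by metis
  have g[measurable]: "g k \<in> borel_measurable borel" for k
  proof (rule borel_measurable_continuous_onI, rule lipschitz_on_continuous_on)
    show "(L k)-lipschitz_on UNIV (g k)" using L by (intro lipschitz_onI) (auto simp: dist_norm)
  qed
  have eu: "(\<lambda>w. euler (g k) (B w) (X w) h n) \<in> borel_measurable M" if h: "0 \<le> h" for k h n
  proof (induction n)
    case 0
    show ?case using X B[of 0] by simp
  next
    case (Suc n)
    note [measurable] = Suc
    have [measurable]: "(\<lambda>w. B w (real (Suc n) * h)) \<in> borel_measurable M" "(\<lambda>w. B w (real n * h)) \<in> borel_measurable M"
      using h by (auto intro!: B)
    show ?case unfolding euler.simps by measurable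
  qed
  define Z where "Z k w = lim (\<lambda>n. euler (g k) (B w) (X w) (d / real (Suc n)) (Suc n))" for k w
  show ?thesis
  proof (rule borel_measurable_LIMSEQ_metric)
    show "Z k \<in> borel_measurable M" for k
      unfolding Z_def using d by (intro borel_measurable_lim_metric eu) auto
    fix w assume w: "w \<in> space M"
    have cy: "continuous_on {0..d} (Y w)" using y[OF w] by (simp add: integral_solution_def)
    then have "bounded (Y w ` {0..d})" by (intro compact_imp_bounded compact_continuous_image) auto
    then obtain K where K: "\<And>t. t \<in> {0..d} \<Longrightarrow> norm (Y w t) \<le> K" unfolding bounded_iff by (metis imageI)
    obtain k0 :: nat where k0: "K < real k0" using reals_Archimedean2 by blast
    have "Z k w = Y w d" if k: "k \<ge> k0" for k
    proof -
      have eq: "g k (Y w s) = f (Y w s)" if "s \<in> {0..d}" for s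
        unfolding g_def using K[OF that] k0 k by (subst closest_point_self) auto
      have "integral {0..t} (\<lambda>s. g k (Y w s)) = integral {0..t} (\<lambda>s. f (Y w s))" if "t \<in> {0..d}" for t
        using that eq by (intro integral_cong) auto
      then have "integral_solution (g k) (B w) (X w) d (Y w)"
        using y[OF w] by (auto simp: integral_solution_def)
      from euler_tendsto[OF L d this] show ?thesis unfolding Z_def by (rule limI)
    qed
    then show "(\<lambda>k. Z k w) \<longlonglongrightarrow> Y w d"
      by (intro tendsto_eventually) (auto simp: eventually_sequentially)
  qed
qed

section \<open>Stationarity, mixing and supports\<close>

text \<open>\<open>f\<close> and \<open>g\<close> may fail to be integrable, so both are truncated; then their expectations agree, and
  dominated convergence applies to the differences, which are bounded after a cut-off at \<open>- b\<close>.\<close>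

lemma (in prob_space) stationary_drift:
  fixes f g :: "'a \<Rightarrow> real"
  assumes [measurable]: "f \<in> borel_measurable M" "g \<in> borel_measurable M"
    and eq: "distr M borel f = distr M borel g"
    and A[measurable]: "A \<in> sets M" and ab: "0 \<le> a" "0 \<le> b"
    and fa: "AE w in M. f w \<le> g w + a" and fb: "AE w in M. w \<notin> A \<longrightarrow> f w \<le> g w - b"
  shows "b * (1 - prob A) \<le> a * prob A"
proof -
  define cl where "cl K x = max (- real K) (min (real K) x)" for K x
  have [measurable]: "cl K \<in> borel_measurable borel" for K unfolding cl_def by measurable
  have cl_bnd: "\<bar>cl K x\<bar> \<le> real K" for K x by (auto simp: cl_def)
  define D where "D K w = max (cl K (f w) - cl K (g w)) (- b)" for K w
  define E where "E w = max (f w - g w) (- b)" for w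
  have int[simp]: "integrable M (\<lambda>w. cl K (f w))" "integrable M (\<lambda>w. cl K (g w))" for K
    by (rule integrable_const_bound[of _ "real K"]; simp add: cl_bnd)+
  have bnd: "AE w in M. norm (D K w) \<le> a + b" for K
  proof -
    \<comment> \<open>Truncation is monotone and 1-Lipschitz, so the upper bound \<open>a\<close>
      survives it. The gap \<open>b\<close> off \<open>A\<close> does not; it is recovered only in
      the limit \<open>E\<close>.\<close>
    have "cl K x - cl K y \<le> a" if "x \<le> y + a" for x y
      using that ab by (auto simp: cl_def max_def min_def)
    then have le: "cl K (f w) - cl K (g w) \<le> a" if "f w \<le> g w + a" for w
      using that by blast
    have "norm (D K w) \<le> a + b" if "f w \<le> g w + a" for w
      using le[OF that] ab unfolding D_def real_norm_def by linarith
    then show ?thesis using fa by (rule eventually_mono[rotated])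
  qed
  have [measurable]: "D K \<in> borel_measurable M" "E \<in> borel_measurable M" for K
    unfolding D_def E_def by measurable
  have lim: "(\<lambda>K. D K w) \<longlonglongrightarrow> E w" for w
  proof (rule tendsto_eventually)
    obtain K :: nat where K: "\<bar>f w\<bar> + \<bar>g w\<bar> < real K" using reals_Archimedean2 by blast
    show "\<forall>\<^sub>F K in sequentially. D K w = E w"
      unfolding eventually_sequentially
    proof (intro exI allI impI)
      fix n assume "K \<le> n"
      then have "\<bar>f w\<bar> \<le> real n" "\<bar>g w\<bar> \<le> real n" using K by linarith+
      then have "cl n (f w) = f w" "cl n (g w) = g w" unfolding cl_def by linarith+
      then show "D n w = E w" by (simp add: D_def E_def)
    qed
  qed
  have intD: "integrable M (D K)" for K
    using bnd by (rule integrable_const_bound) simp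
  have pos: "0 \<le> (\<integral>w. D K w \<partial>M)" for K
  proof -
    have "(\<integral>w. cl K (f w) \<partial>M) = (\<integral>x. cl K x \<partial>distr M borel f)" by (simp add: integral_distr)
    also have "\<dots> = (\<integral>w. cl K (g w) \<partial>M)" unfolding eq by (simp add: integral_distr)
    finally have "0 = (\<integral>w. cl K (f w) - cl K (g w) \<partial>M)" by simp
    also have "\<dots> \<le> (\<integral>w. D K w \<partial>M)" by (intro integral_mono intD) (auto simp: D_def)
    finally show ?thesis .
  qed
  have limI: "(\<lambda>K. \<integral>w. D K w \<partial>M) \<longlonglongrightarrow> (\<integral>w. E w \<partial>M)"
    by (rule integral_dominated_convergence[where w = "\<lambda>_. a + b"]) (simp_all add: lim bnd[simplified])
  have intE: "integrable M E"
    by (rule integrable_dominated_convergence[where w = "\<lambda>_. a + b" and s = D]) (simp_all add: lim bnd[simplified])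
  have intA: "integrable M (indicat_real A)"
    by (rule integrable_real_indicator) (auto simp: less_top[symmetric])
  have "0 \<le> (\<integral>w. E w \<partial>M)" using limI pos by (intro LIMSEQ_le_const) auto
  \<comment> \<open>Almost surely \<open>E\<close> is at most \<open>a\<close> on \<open>A\<close>
    and equal to - b off \<open>A\<close>.\<close>
  also have "\<dots> \<le> (\<integral>w. (a + b) * indicator A w - b \<partial>M)"
  proof (rule integral_mono_AE[OF intE])
    show "AE w in M. E w \<le> (a + b) * indicator A w - b"
      using fa fb by eventually_elim (use ab in \<open>auto simp: E_def indicator_def\<close>)
  qed (use intA in simp)
  also have "\<dots> = (a + b) * prob A - b" using intA by (simp add: prob_space)
  finally show ?thesis by (simp add: algebra_simps)
qed

lemma distr_fst_pair:
  assumes "prob_space Q"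
  shows "distr (M \<Otimes>\<^sub>M Q) M fst = M"
proof (rule measure_eqI)
  interpret Q: prob_space Q by fact
  fix A assume "A \<in> sets (distr (M \<Otimes>\<^sub>M Q) M fst)"
  then have A: "A \<in> sets M" by simp
  have "fst -` A \<inter> space (M \<Otimes>\<^sub>M Q) = A \<times> space Q"
    using sets.sets_into_space[OF A] by (auto simp: space_pair_measure)
  then show "emeasure (distr (M \<Otimes>\<^sub>M Q) M fst) A = emeasure M A"
    using A by (simp add: emeasure_distr Q.emeasure_pair_measure_Times Q.emeasure_space_1)
qed simp

text \<open>By \<open>indep\<close>, \<open>K n (v, w)\<close> asymptotically forgets \<open>v\<close>; hence
  the probability that \<open>v \<in> G'\<close> and \<open>K n (v, w) \<in> E\<close> tends to the product, first for the generators.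
  With \<open>E = G\<close> this gives \<open>P(G) = P(G)\<^sup>2\<close>.\<close>

lemma mixing_zero_one:
  fixes K :: "nat \<Rightarrow> 'b \<times> 'a \<Rightarrow> 'a"
  assumes Q: "prob_space Q" and P: "prob_space P"
    and K[measurable]: "\<And>n. K n \<in> Q \<Otimes>\<^sub>M P \<rightarrow>\<^sub>M P" and inv: "\<And>n. distr (Q \<Otimes>\<^sub>M P) P (K n) = P"
    and gen: "sets P = sigma_sets (space P) \<E>" "\<E> \<subseteq> sets P" "Int_stable \<E>"
    and indep: "\<And>E. E \<in> \<E> \<Longrightarrow> \<exists>n0. \<forall>n\<ge>n0. \<exists>E'\<in>sets P. \<forall>v\<in>space Q. \<forall>w\<in>space P. K n (v, w) \<in> E \<longleftrightarrow> w \<in> E'"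
    and G: "G \<in> sets P" "G' \<in> sets Q" "measure Q G' = measure P G"
    and stable: "\<And>n v w. v \<in> G' \<Longrightarrow> w \<in> space P \<Longrightarrow> K n (v, w) \<in> G"
  shows "measure P G = 0 \<or> measure P G = 1"
proof -
  interpret Q: prob_space Q by fact
  interpret P: prob_space P by fact
  interpret QP: pair_prob_space Q P ..
  have inv': "measure (Q \<Otimes>\<^sub>M P) {z \<in> space (Q \<Otimes>\<^sub>M P). K n z \<in> E} = measure P E" if "E \<in> sets P" for E n
  proof -
    have "measure P E = measure (distr (Q \<Otimes>\<^sub>M P) P (K n)) E" by (simp add: inv)
    also have "\<dots> = measure (Q \<Otimes>\<^sub>M P) (K n -` E \<inter> space (Q \<Otimes>\<^sub>M P))"
      using that by (intro measure_distr) auto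
    finally show ?thesis by (simp add: vimage_def Int_def conj_commute)
  qed
  define m where "m n E = measure (Q \<Otimes>\<^sub>M P) {z \<in> space (Q \<Otimes>\<^sub>M P). fst z \<in> G' \<and> K n z \<in> E}" for n E
  have meas[measurable]: "{z \<in> space (Q \<Otimes>\<^sub>M P). fst z \<in> G' \<and> K n z \<in> E} \<in> sets (Q \<Otimes>\<^sub>M P)" if "E \<in> sets P" for n E
    using that G by measurable
  have rect: "measure (Q \<Otimes>\<^sub>M P) (A \<times> B) = measure Q A * measure P B" if "A \<in> sets Q" "B \<in> sets P" for A B
    using that unfolding measure_def by (simp add: P.emeasure_pair_measure_Times enn2real_mult)
  have mixing: "(\<lambda>n. m n E) \<longlonglongrightarrow> measure P G * measure P E" if E: "E \<in> sets P" for E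
  proof -
    have "\<E> \<subseteq> Pow (space P)" using gen(2) sets.sets_into_space by blast
    moreover have "E \<in> sigma_sets (space P) \<E>" using E gen(1) by simp
    ultimately have "Int_stable \<E>" "\<E> \<subseteq> Pow (space P)" "E \<in> sigma_sets (space P) \<E>"
      using gen(3) by auto
    then show ?thesis
    proof (induction rule: sigma_sets_induct_disjoint)
      case (basic E)
      obtain n0 where n0: "\<And>n. n \<ge> n0 \<Longrightarrow> \<exists>E'\<in>sets P. \<forall>v\<in>space Q. \<forall>w\<in>space P. K n (v, w) \<in> E \<longleftrightarrow> w \<in> E'"
        using indep[OF basic] by blast
      have "m n E = measure P G * measure P E" if n: "n \<ge> n0" for n
      proof -
        obtain E' where E': "E' \<in> sets P" "\<And>v w. v \<in> space Q \<Longrightarrow> w \<in> space P \<Longrightarrow> K n (v, w) \<in> E \<longleftrightarrow> w \<in> E'"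
          using n0[OF n] by blast
        have "{z \<in> space (Q \<Otimes>\<^sub>M P). K n z \<in> E} = space Q \<times> E'"
          using E' sets.sets_into_space[OF E'(1)] by (auto simp: space_pair_measure)
        \<comment> \<open>Invariance identifies the probability of \<open>E\<close> with that of an
          event in the fresh noise alone, so the joint probability factorizes exactly from
          \<open>n0\<close> on.\<close>
        then have "measure P E = measure P E'"
          using inv'[of E n] basic gen(2) rect[of "space Q" E'] E' by (auto simp: Q.prob_space)
        moreover have "{z \<in> space (Q \<Otimes>\<^sub>M P). fst z \<in> G' \<and> K n z \<in> E} = G' \<times> E'"
          using E' sets.sets_into_space[OF E'(1)] sets.sets_into_space[OF G(2)]
          by (auto simp: space_pair_measure)
        ultimately show ?thesis using rect[OF G(2) E'(1)] G(3) by (simp add: m_def)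
      qed
      then show ?case by (intro tendsto_eventually) (auto simp: eventually_sequentially)
    next
      case empty
      then show ?case by (simp add: m_def)
    next
      case (compl E)
      have E[measurable]: "E \<in> sets P" using compl(1) gen(1) by simp
      have "m n (space P - E) = measure P G - m n E" for n
      proof -
        have "measure (Q \<Otimes>\<^sub>M P) (G' \<times> space P) = measure P G"
          using rect[OF G(2) sets.top] G(3) by (simp add: P.prob_space)
        moreover have "{z \<in> space (Q \<Otimes>\<^sub>M P). fst z \<in> G' \<and> K n z \<in> space P - E} =
          (G' \<times> space P) - {z \<in> space (Q \<Otimes>\<^sub>M P). fst z \<in> G' \<and> K n z \<in> E}"
          using sets.sets_into_space[OF G(2)] measurable_space[OF K] by (auto simp: space_pair_measure)
        moreover have "{z \<in> space (Q \<Otimes>\<^sub>M P). fst z \<in> G' \<and> K n z \<in> E} \<subseteq> G' \<times> space P"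
          by (auto simp: space_pair_measure)
        ultimately show ?thesis
          unfolding m_def using G E by (simp add: QP.finite_measure_Diff)
      qed
      moreover have "(\<lambda>n. measure P G - m n E) \<longlonglongrightarrow> measure P G - measure P G * measure P E"
        by (intro tendsto_intros compl)
      moreover have "measure P (space P - E) = 1 - measure P E" by (rule P.prob_compl) simp
      ultimately show ?case by (simp add: right_diff_distrib)
    next
      case (union A)
      have A[measurable]: "A i \<in> sets P" for i using union(2) gen(1) by auto
      have sums: "(\<lambda>i. m n (A i)) sums m n (\<Union>i. A i)" for n
      proof -
        have "(\<lambda>i. m n (A i)) sums measure (Q \<Otimes>\<^sub>M P) (\<Union>i. {z \<in> space (Q \<Otimes>\<^sub>M P). fst z \<in> G' \<and> K n z \<in> A i})"
          unfolding m_def using union(1)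
          by (intro QP.finite_measure_UNION) (auto simp: disjoint_family_on_def)
        also have "(\<Union>i. {z \<in> space (Q \<Otimes>\<^sub>M P). fst z \<in> G' \<and> K n z \<in> A i}) = 
            {z \<in> space (Q \<Otimes>\<^sub>M P). fst z \<in> G' \<and> K n z \<in> (\<Union>i. A i)}" by auto
        finally show ?thesis by (simp add: m_def)
      qed
      have sumsP: "(\<lambda>i. measure P (A i)) sums measure P (\<Union>i. A i)"
        using union(1) by (intro P.finite_measure_UNION) auto
      \<comment> \<open>Invariance provides a summable bound uniform in n, so Tannery's theorem
        exchanges the limit with the sum over the disjoint sets.\<close>
      have le: "m n (A i) \<le> measure P (A i)" for n i
        unfolding m_def inv'[OF A, of n i, symmetric] by (intro QP.finite_measure_mono) auto
      have "(\<lambda>n. \<Sum>i. m n (A i)) \<longlonglongrightarrow> (\<Sum>i. measure P G * measure P (A i))"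
      proof (rule tannerys_theorem[THEN conjunct2, THEN conjunct2])
        show "\<forall>\<^sub>F (k, n) in sequentially \<times>\<^sub>F sequentially. norm (m n (A k)) \<le> measure P (A k)"
          using le by (intro always_eventually) (auto simp: m_def)
      qed (use union(3) sumsP in \<open>auto simp: sums_iff\<close>)
      moreover have "(\<Sum>i. m n (A i)) = m n (\<Union>i. A i)" for n using sums sums_unique by metis
      moreover have "(\<Sum>i. measure P G * measure P (A i)) = measure P G * measure P (\<Union>i. A i)"
        using sums_mult[OF sumsP] sums_unique by metis
      ultimately show ?case by simp
    qed
  qed
  have "m n G = measure P G" for n
  proof -
    have "{z \<in> space (Q \<Otimes>\<^sub>M P). fst z \<in> G' \<and> K n z \<in> G} = G' \<times> space P"
      using stable sets.sets_into_space[OF G(2)] by (auto simp: space_pair_measure)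
    then show ?thesis using rect[OF G(2) sets.top] G(3) by (simp add: m_def P.prob_space)
  qed
  then have "measure P G = measure P G * measure P G"
    using mixing[OF G(1)] by (simp add: LIMSEQ_const_iff)
  then show ?thesis by simp
qed

text \<open>Every point of \<open>U\<close> has a null basic neighbourhood, and a countable basis
  leaves only countably many of these to unite.\<close>

lemma emeasure_disjoint_support:
  fixes \<nu> :: "'a::second_countable_topology measure"
  assumes \<nu>: "sets \<nu> = sets borel" and U: "open U" "U \<inter> measure_support \<nu> = {}"
  shows "emeasure \<nu> U = 0"
proof -
  obtain D :: "'a set set" where D: "countable D" "topological_basis D"
    using ex_countable_basis by blast
  define I where "I = {V \<in> D. emeasure \<nu> V = 0}"
  have "U \<subseteq> \<Union>I"
  proof
    fix x assume x: "x \<in> U"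
    then have "x \<notin> measure_support \<nu>" using U(2) by blast
    then obtain V where V: "open V" "x \<in> V" "emeasure \<nu> V = 0"
      by (auto simp: measure_support_def)
    obtain W where W: "W \<in> D" "x \<in> W" "W \<subseteq> V" using topological_basisE[OF D(2) V(1,2)] by blast
    have "emeasure \<nu> W \<le> emeasure \<nu> V" using W(3) V(1) \<nu> by (intro emeasure_mono) auto
    then have "emeasure \<nu> W = 0" using V(3) by simp
    then show "x \<in> \<Union>I" using W by (auto simp: I_def)
  qed
  moreover have "(\<Union>V\<in>I. V) \<in> null_sets \<nu>"
  proof (rule null_sets_UN')
    show "countable I" using D(1) unfolding I_def by (rule countable_subset[rotated]) auto
    show "V \<in> null_sets \<nu>" if "V \<in> I" for V
      using that topological_basis_open[OF D(2)] by (auto simp: I_def \<nu>)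
  qed
  ultimately show ?thesis using U(1) \<nu> by (intro null_setsD1 null_sets_subset[of "\<Union>I" \<nu> U]) auto
qed

text \<open>In general only the closure of the image is obtained. Finiteness makes the image closed,
  so its complement is open and has a null preimage.\<close>

lemma measure_support_distr:
  fixes \<nu> :: "'a::{second_countable_topology, t2_space} measure" and f :: "'a \<Rightarrow> 'b::{second_countable_topology, t2_space}"
  assumes \<nu>: "sets \<nu> = sets borel" and f: "continuous_on UNIV f" and fin: "finite (measure_support \<nu>)"
  shows "measure_support (distr \<nu> borel f) = f ` measure_support \<nu>"
proof -
  have op: "open (f -` U)" if "open U" for U
    using f that by (simp add: continuous_on_open_vimage)
  have "f \<in> borel_measurable \<nu>"
    using borel_measurable_continuous_onI[OF f] measurable_cong_sets[OF \<nu> refl] by blast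
  then have em: "emeasure (distr \<nu> borel f) U = emeasure \<nu> (f -` U)" if "open U" for U
    using that sets_eq_imp_space_eq[OF \<nu>] by (subst emeasure_distr) auto
  show ?thesis
  proof (intro set_eqI iffI)
    fix y assume "y \<in> f ` measure_support \<nu>"
    then obtain x where x: "y = f x" "x \<in> measure_support \<nu>" by blast
    show "y \<in> measure_support (distr \<nu> borel f)"
      unfolding measure_support_def using x op em by (auto simp: measure_support_def)
  next
    fix y assume y: "y \<in> measure_support (distr \<nu> borel f)"
    show "y \<in> f ` measure_support \<nu>"
    proof (rule ccontr)
      assume n: "y \<notin> f ` measure_support \<nu>"
      define V where "V = - (f ` measure_support \<nu>)"
      have V: "open V" "y \<in> V" using n fin by (auto simp: V_def intro!: open_Compl finite_imp_closed)
      have "emeasure \<nu> (f -` V) = 0"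
        by (rule emeasure_disjoint_support[OF \<nu> op[OF V(1)]]) (auto simp: V_def)
      moreover have "emeasure (distr \<nu> borel f) V > 0" using y V by (auto simp: measure_support_def)
      ultimately show False using em[OF V(1)] by simp
    qed
  qed
qed

section \<open>The stochastic equation\<close>

text \<open>Collects what makes sense for any disintegrated invariant measure. \<open>\<Phi>\<close>
  is known merely to solve the equation path by path; uniqueness, continuity and measurability are
  derived below.\<close>

locale noisy_sde =
  fixes H \<alpha> C1 C2 C3 CF :: real
    and N :: nat
    and P :: "('n::finite) path measure"
    and DH :: "'n path \<Rightarrow> 'n path"
    and F :: "real ^ 'n \<Rightarrow> real ^ 'n"
    and \<sigma> :: "real ^ 'n ^ 'n"
    and \<Phi> :: "real \<Rightarrow> 'n path \<times> 'n path \<Rightarrow> real ^ 'n \<Rightarrow> real ^ 'n"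
    and \<mu> :: "((real ^ 'n) \<times> 'n path) measure"
    and Bt :: "'n path set"
    and \<kappa> :: "'n path \<Rightarrow> (real ^ 'n) measure"
  assumes hurst: "0 < H" "H < 1"
    and noise: "wiener_measure H P" "fractional_operator H P \<alpha> DH"
    and standing: "standing_conditions H F \<sigma> C1 C2 C3 CF N"
    and flow: "\<forall>w \<in> path_space H \<times> path_space H. \<forall>x. sde_solution F \<sigma> DH w x (\<lambda>t. \<Phi> t w x)"
    and invariant: "invariant_measure P \<Phi> \<mu>"
    and disint: "disintegration P \<Phi> \<mu> Bt \<kappa>"
begin

lemma hurst': "0 < 1 - H" "1 - H < 1"
  using hurst by auto

lemma prob_space_P: "prob_space P" and space_P: "space P = path_space H"
  and sets_P: "sets P = sets (path_borel H)"
  using noise(1) by (auto simp: wiener_measure_def)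

lemma prob_space_\<mu>: "prob_space \<mu>" and sets_\<mu>: "sets \<mu> = sets (borel \<Otimes>\<^sub>M P)"
  and snd_\<mu>: "distr \<mu> P snd = P"
  using invariant by (auto simp: invariant_measure_def)

lemma space_\<mu>: "space \<mu> = UNIV \<times> path_space H"
  using sets_eq_imp_space_eq[OF sets_\<mu>] by (simp add: space_pair_measure space_P)

lemma sets_Bt: "Bt \<in> sets P" and emeasure_Bt: "emeasure P Bt = 1"
  using disint by (auto simp: disintegration_def)

lemma Bt_path_space: "w \<in> Bt \<Longrightarrow> w \<in> path_space H"
  using sets.sets_into_space[OF sets_Bt] space_P by auto

lemma glue_Bt: "v \<in> Bt \<Longrightarrow> w \<in> path_space H \<Longrightarrow> 0 \<le> t \<Longrightarrow> glue t (v, w) \<in> Bt"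
  and \<kappa>_glue: "v \<in> Bt \<Longrightarrow> w \<in> path_space H \<Longrightarrow> 0 \<le> t \<Longrightarrow> distr (\<kappa> v) borel (\<Phi> t (v, w)) = \<kappa> (glue t (v, w))"
  using disint by (auto simp: disintegration_def space_P)

lemma sets_\<kappa>: "w \<in> Bt \<Longrightarrow> sets (\<kappa> w) = sets borel"
  using disint by (auto simp: disintegration_def space_P Bt_path_space)

lemma C3_pos: "0 < C3"
  and F_onesided: "(F x - F y) \<bullet> (x - y) \<le> C3 * (norm (x - y))\<^sup>2"
  using standing by (auto simp: standing_conditions_def)

text \<open>The polynomial bound on the derivative is uniform on a ball, which is convex, so the
  mean value inequality applies. The cut-off Euler scheme relies on this.\<close>

lemma F_locally_lipschitz:
  "\<exists>L. \<forall>x\<in>cball 0 K. \<forall>y\<in>cball 0 K. norm (F x - F y) \<le> L * norm (x - y)"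
proof (intro exI ballI)
  fix x y :: "real ^ 'n" assume xy: "x \<in> cball 0 K" "y \<in> cball 0 K"
  show "norm (F x - F y) \<le> (CF * (1 + K) ^ N) * norm (x - y)"
  proof (rule differentiable_bound[OF convex_cball _ _ xy])
    fix z :: "real ^ 'n" assume z: "z \<in> cball 0 K"
    have "F differentiable (at z)" using standing by (simp add: standing_conditions_def)
    then show "(F has_derivative frechet_derivative F (at z)) (at z within cball 0 K)"
      using frechet_derivative_works has_derivative_at_withinI by blast
    have "onorm (frechet_derivative F (at z)) \<le> CF * (1 + norm z) ^ N"
      using standing by (simp add: standing_conditions_def)
    also have "\<dots> \<le> CF * (1 + K) ^ N"
      using z standing by (intro mult_left_mono power_mono) (auto simp: standing_conditions_def)
    finally show "onorm (frechet_derivative F (at z)) \<le> CF * (1 + K) ^ N" .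
  qed
qed

lemma F_continuous: "continuous_on UNIV F"
proof -
  have "isCont F x" for x
    using standing by (intro differentiable_imp_continuous_within) (simp add: standing_conditions_def)
  then show ?thesis by (simp add: continuous_on_eq_continuous_within)
qed

lemma \<Phi>_integral_solution:
  assumes "v \<in> path_space H" "w \<in> path_space H"
  shows "integral_solution F (\<lambda>t. \<sigma> *v fbm DH t (v, w)) x d (\<lambda>t. \<Phi> t (v, w) x)"
proof -
  have "sde_solution F \<sigma> DH (v, w) x (\<lambda>t. \<Phi> t (v, w) x)" using flow assms by blast
  then show ?thesis unfolding sde_solution_def integral_solution_def
    by (auto intro: continuous_on_subset)
qed

lemma \<Phi>_continuous_time:
  assumes "v \<in> path_space H" "w \<in> path_space H"
  shows "continuous_on {0..d} (\<lambda>t. \<Phi> t (v, w) x)"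
  using \<Phi>_integral_solution[OF assms] by (simp add: integral_solution_def)

lemma \<Phi>_lipschitz:
  assumes "v \<in> path_space H" "w \<in> path_space H" "0 \<le> t"
  shows "norm (\<Phi> t (v, w) x - \<Phi> t (v, w) y) \<le> norm (x - y) * exp (C3 * t)"
  using solution_difference[OF assms(3) F_continuous \<Phi>_integral_solution[OF assms(1,2)] \<Phi>_integral_solution[OF assms(1,2)] F_onesided] .

lemma \<Phi>_continuous:
  assumes "v \<in> path_space H" "w \<in> path_space H" "0 \<le> t"
  shows "continuous_on UNIV (\<Phi> t (v, w))"
proof (rule lipschitz_on_continuous_on)
  show "(exp (C3 * t))-lipschitz_on UNIV (\<Phi> t (v, w))"
    using \<Phi>_lipschitz[OF assms] by (intro lipschitz_onI) (auto simp: dist_norm mult.commute)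
qed

lemma DH_path_space: "w \<in> path_space H \<Longrightarrow> DH w \<in> path_space (1 - H)"
  using noise(2) continuous_map_funspace[of "path_topology H" "path_topology (1 - H)" DH]
  by (auto simp: fractional_operator_def topspace_path_topology hurst Pi_iff)

text \<open>At time 0 the glued path is \<open>v\<close> itself, and \<open>DH v\<close> vanishes at
  0, so the noise starts at 0. Through this the initial law enters when the time window shrinks to a
  point.\<close>

lemma \<Phi>_0:
  assumes "v \<in> path_space H" "w \<in> path_space H"
  shows "\<Phi> 0 (v, w) x = x"
proof -
  have "v s = 0" if "s > 0" for s using assms(1) that by (simp add: path_space_def)
  moreover have "v 0 = 0" "w 0 = 0" using assms by (simp_all add: path_space_def)
  ultimately have "glue 0 (v, w) = v"
    by (auto simp: glue_def fun_eq_iff)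
  moreover have "DH v 0 = 0" using DH_path_space[OF assms(1)] by (simp add: path_space_def)
  ultimately have "fbm DH 0 (v, w) = 0" by (simp add: fbm_def)
  then show ?thesis using \<Phi>_integral_solution[OF assms, of x 0] by (simp add: integral_solution_def)
qed

text \<open>The stopped path is in the space because \<open>glue t\<close> is linear and \<open>Bt\<close> is not empty.\<close>

lemma glue_zero_path_space:
  fixes w :: "'n path"
  assumes w: "w \<in> path_space H" and t: "0 \<le> t"
  shows "glue t (\<lambda>_. 0, w) \<in> path_space H"
proof -
  obtain v where v: "v \<in> Bt" using emeasure_Bt by fastforce
  have "(\<lambda>s. glue t (v, w) s - glue t (v, \<lambda>_. 0) s) \<in> path_space H"
    by (intro path_space_diff Bt_path_space[OF glue_Bt] v w t path_space_zero)
  also have "(\<lambda>s. glue t (v, w) s - glue t (v, \<lambda>_. 0) s) = glue t (\<lambda>_. 0, w)"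
    by (auto simp: glue_def)
  finally show ?thesis .
qed

text \<open>Shifting the glued path back recovers \<open>v\<close> and a forward path that agrees
  with \<open>w\<close> on [- t, 0], the only part the equation sees up to time t; uniqueness of
  solutions then gives the claim. For t > 0, \<open>wiener_shift (- t)\<close> takes its
  negative-time branch.\<close>

lemma cocycle_glue:
  assumes v: "v \<in> Bt" and w: "w \<in> path_space H" and t: "0 < t"
  shows "cocycle \<Phi> t (glue t (v, w)) x = \<Phi> t (v, w) x"
proof -
  define u where "u = glue t (v, w)"
  define w' where "w' = glue t (\<lambda>_. 0, u)"
  have v': "v \<in> path_space H" using v by (rule Bt_path_space)
  have v0: "v 0 = 0" "\<And>s. s > 0 \<Longrightarrow> v s = 0" and w0: "w 0 = 0" using v' w by (auto simp: path_space_def)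
  have "u \<in> path_space H" unfolding u_def using t by (intro Bt_path_space[OF glue_Bt[OF v w]]) auto
  then have w'H: "w' \<in> path_space H" unfolding w'_def using t by (intro glue_zero_path_space) auto
  have "back_shift t u = v"
    using t v0 w0 by (auto simp: back_shift_def u_def glue_def fun_eq_iff)
  then have shift: "wiener_shift (- t) (u, \<lambda>_. 0) = (v, w')"
    using t by (simp add: wiener_shift_def w'_def)
  have w'_eq: "w' s = w s" if "- t \<le> s" "s \<le> 0" for s
    using that t w0 by (auto simp: w'_def u_def glue_def)
  have "glue s (v, w') = glue s (v, w)" if "0 \<le> s" "s \<le> t" for s
    using that by (auto simp: glue_def fun_eq_iff w'_eq)
  then have "fbm DH s (v, w') = fbm DH s (v, w)" if "0 \<le> s" "s \<le> t" for s
    using that by (simp add: fbm_def)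
  then have sol: "integral_solution F (\<lambda>t. \<sigma> *v fbm DH t (v, w)) x t (\<lambda>t. \<Phi> t (v, w') x)"
    using \<Phi>_integral_solution[OF v' w'H, of x t] by (auto simp: integral_solution_def)
  have "norm (\<Phi> t (v, w') x - \<Phi> t (v, w) x) \<le> norm (x - x) * exp (C3 * t)"
    using t by (intro solution_difference[OF _ F_continuous sol \<Phi>_integral_solution[OF v' w, of x t] F_onesided]) simp
  then show ?thesis unfolding cocycle_def u_def[symmetric] shift by simp
qed

lemma measure_support_glue:
  assumes v: "v \<in> Bt" and w: "w \<in> path_space H" and t: "0 \<le> t" and fin: "finite (measure_support (\<kappa> v))"
  shows "measure_support (\<kappa> (glue t (v, w))) = \<Phi> t (v, w) ` measure_support (\<kappa> v)"
  unfolding \<kappa>_glue[OF v w t, symmetric]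
  by (rule measure_support_distr[OF sets_\<kappa>[OF v] \<Phi>_continuous[OF Bt_path_space[OF v] w t] fin])

text \<open>The disintegration controls \<open>glue\<close> and the images of
  \<open>\<kappa>\<close> only for pasts in \<open>Bt\<close>. On the restricted spaces, which lose
  no mass, gluing therefore always stays inside the path space.\<close>

definition "PB = restrict_space P Bt"
definition "\<mu>B = restrict_space \<mu> (UNIV \<times> Bt)"

lemma space_PB: "space PB = Bt"
  using sets.sets_into_space[OF sets_Bt] by (auto simp: PB_def space_restrict_space)

lemma sets_PB: "A \<in> sets PB \<longleftrightarrow> A \<subseteq> Bt \<and> A \<in> sets P"
  unfolding PB_def using sets_Bt by (subst sets_restrict_space_iff) auto

lemma measure_PB: "A \<in> sets PB \<Longrightarrow> measure PB A = measure P A"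
  using sets_PB[of A] measure_restrict_space[of Bt P A] sets_Bt by (auto simp: PB_def)

lemma prob_space_PB: "prob_space PB"
  unfolding PB_def using sets_Bt emeasure_Bt by (intro prob_space_restrict_space)

lemma AE_Bt: "AE w in P. w \<in> Bt"
  using prob_space.AE_in_set_eq_1[OF prob_space_P sets_Bt] emeasure_Bt by (simp add: measure_def)

lemma snd_measurable_\<mu>: "snd \<in> \<mu> \<rightarrow>\<^sub>M P" and fst_measurable_\<mu>: "fst \<in> borel_measurable \<mu>"
  by (simp_all add: measurable_cong_sets[OF sets_\<mu> refl])

lemma sets_UNIV_Bt: "UNIV \<times> Bt \<in> sets \<mu>"
  unfolding sets_\<mu> using sets_Bt by (auto intro!: pair_measureI)

lemma AE_\<mu>_Bt: "AE z in \<mu>. snd z \<in> Bt"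
proof -
  have "AE w in distr \<mu> P snd. w \<in> Bt" using AE_Bt by (subst snd_\<mu>)
  then show ?thesis by (rule AE_distrD[OF snd_measurable_\<mu>])
qed

lemma emeasure_UNIV_Bt: "emeasure \<mu> (UNIV \<times> Bt) = 1"
proof -
  have "AE z in \<mu>. z \<in> UNIV \<times> Bt" using AE_\<mu>_Bt by eventually_elim auto
  then show ?thesis
    using prob_space.AE_in_set_eq_1[OF prob_space_\<mu> sets_UNIV_Bt] 
    by (simp add: finite_measure.emeasure_eq_measure prob_space.axioms(1)[OF prob_space_\<mu>])
qed

lemma prob_space_\<mu>B: "prob_space \<mu>B"
  unfolding \<mu>B_def using sets_UNIV_Bt emeasure_UNIV_Bt by (intro prob_space_restrict_space)

lemma space_\<mu>B: "space \<mu>B = UNIV \<times> Bt"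
  using Bt_path_space by (auto simp: \<mu>B_def space_restrict_space space_\<mu>)

lemma sets_\<mu>B: "A \<in> sets \<mu>B \<longleftrightarrow> A \<subseteq> UNIV \<times> Bt \<and> A \<in> sets \<mu>"
  unfolding \<mu>B_def using sets_UNIV_Bt by (subst sets_restrict_space_iff) auto

lemma emeasure_\<mu>B: "A \<in> sets \<mu>B \<Longrightarrow> emeasure \<mu>B A = emeasure \<mu> A"
  using sets_\<mu>B[of A] emeasure_restrict_space[of "UNIV \<times> Bt" \<mu> A] sets_UNIV_Bt by (auto simp: \<mu>B_def)

lemma snd_measurable_\<mu>B: "snd \<in> \<mu>B \<rightarrow>\<^sub>M PB"
  unfolding PB_def
proof (rule measurable_restrict_space2)
  show "snd \<in> \<mu>B \<rightarrow>\<^sub>M P" unfolding \<mu>B_def by (rule measurable_restrict_space1[OF snd_measurable_\<mu>])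
qed (auto simp: space_\<mu>B)

lemma fst_measurable_\<mu>B: "fst \<in> borel_measurable \<mu>B"
  unfolding \<mu>B_def by (rule measurable_restrict_space1[OF fst_measurable_\<mu>])

lemma AE_\<mu>B_I: "AE w in P. w \<in> Bt \<longrightarrow> Q w \<Longrightarrow> AE z in \<mu>B. Q (snd z)"
proof -
  assume "AE w in P. w \<in> Bt \<longrightarrow> Q w"
  then have "AE w in distr \<mu> P snd. w \<in> Bt \<longrightarrow> Q w" by (subst snd_\<mu>)
  then have "AE z in \<mu>. snd z \<in> Bt \<longrightarrow> Q (snd z)" by (rule AE_distrD[OF snd_measurable_\<mu>])
  then show ?thesis unfolding \<mu>B_def using sets_UNIV_Bt
    by (subst AE_restrict_space_iff) (auto elim: eventually_mono)
qed

section \<open>Measurability of the noise and of the flow\<close>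

lemma sets_P_evaluations: "sets P = sigma_sets (path_space H) (evaluations H)"
proof
  show "sets P \<subseteq> sigma_sets (path_space H) (evaluations H)"
    unfolding sets_P by (rule sets_path_borel_evaluations[OF hurst])
  show "sigma_sets (path_space H) (evaluations H) \<subseteq> sets P"
    unfolding space_P[symmetric]
  proof (rule sets.sigma_sets_subset, rule subsetI)
    fix E :: "'n path set" assume "E \<in> evaluations H"
    then obtain t A where E: "E = {w \<in> path_space H. w t \<in> A}" "t \<le> 0" "A \<in> sets borel"
      by (auto simp: evaluations_def)
    \<comment> \<open>That evaluations are measurable is part of \<open>brownian_motion\<close>,
      used here at the time - t.\<close>
    have "(\<lambda>w. w (- (- t))) \<in> borel_measurable P"
      using noise(1) E(2) unfolding wiener_measure_def brownian_motion_def by (metis neg_0_le_iff_le)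
    then have "(\<lambda>w. w t) -` A \<inter> space P \<in> sets P" using E(3) by (simp add: measurable_sets)
    then show "E \<in> sets P" by (simp add: E(1) space_P vimage_def Int_def conj_commute)
  qed
qed

lemma evaluation_measurable: "(\<lambda>w. w t) \<in> borel_measurable P"
proof (cases "t \<le> 0")
  case True
  then have "(\<lambda>w. w (- (- t))) \<in> borel_measurable P"
    using noise(1) unfolding wiener_measure_def brownian_motion_def by (metis neg_0_le_iff_le)
  then show ?thesis by simp
next
  case False
  then have "w t = 0" if "w \<in> space P" for w using that by (auto simp: space_P path_space_def)
  then show ?thesis by (subst measurable_cong[of P _ "\<lambda>_. 0"]) auto
qed

text \<open>It suffices to test generating cylinders, and an evaluation of a glued path is a
  difference of two evaluations of its parts.\<close>

lemma glue_measurable: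
  assumes t: "0 \<le> t"
  shows "glue t \<in> PB \<Otimes>\<^sub>M P \<rightarrow>\<^sub>M P"
proof (rule measurable_sigma_sets[OF sets_P_evaluations evaluations_Pow])
  show "glue t \<in> space (PB \<Otimes>\<^sub>M P) \<rightarrow> path_space H"
    using t by (auto simp: space_pair_measure space_PB space_P intro!: Bt_path_space glue_Bt)
  have [measurable]: "(\<lambda>w. w s) \<in> borel_measurable P" "(\<lambda>w. w s) \<in> borel_measurable PB" for s
    using evaluation_measurable by (auto simp: PB_def intro: measurable_restrict_space1)
  fix E :: "'n path set" assume "E \<in> evaluations H"
  then obtain s A where E: "E = {w \<in> path_space H. w s \<in> A}" "s \<le> 0" "A \<in> sets borel"
    by (auto simp: evaluations_def)
  have "(\<lambda>z. glue t z s) \<in> borel_measurable (PB \<Otimes>\<^sub>M P)"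
    unfolding glue_def case_prod_beta
    by (cases "s > 0"; cases "- t \<le> s") (simp_all, measurable)
  then have "(\<lambda>z. glue t z s) -` A \<inter> space (PB \<Otimes>\<^sub>M P) \<in> sets (PB \<Otimes>\<^sub>M P)"
    using E(3) by (rule measurable_sets)
  also have "(\<lambda>z. glue t z s) -` A \<inter> space (PB \<Otimes>\<^sub>M P) = glue t -` E \<inter> space (PB \<Otimes>\<^sub>M P)"
    using t by (auto simp: E(1) space_pair_measure space_PB space_P intro!: Bt_path_space glue_Bt)
  finally show "glue t -` E \<inter> space (PB \<Otimes>\<^sub>M P) \<in> sets (PB \<Otimes>\<^sub>M P)" .
qed

lemma fbm_measurable:
  assumes t: "0 \<le> t"
  shows "fbm DH t \<in> borel_measurable (PB \<Otimes>\<^sub>M P)"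
proof -
  have "DH \<in> path_borel H \<rightarrow>\<^sub>M path_borel (1 - H)"
    using noise(2) by (intro continuous_map_path_measurable hurst hurst') (simp add: fractional_operator_def)
  then have DH: "DH \<in> P \<rightarrow>\<^sub>M path_borel (1 - H)"
    using measurable_cong_sets[OF sets_P refl] by blast
  \<comment> \<open>That the image of \<open>P\<close> is a fractional Brownian motion includes the
    measurability of evaluations for the Borel sets of the target space.\<close>
  have "(\<lambda>w :: 'n path. w (- t)) \<in> borel_measurable (distr P (path_borel (1 - H)) DH)"
    using noise(2) t unfolding fractional_operator_def fractional_brownian_motion_def by blast
  then have ev: "(\<lambda>w :: 'n path. w (- t)) \<in> borel_measurable (path_borel (1 - H))" by simp
  have "(\<lambda>z. - (\<lambda>w. w (- t)) (DH (glue t z))) \<in> borel_measurable (PB \<Otimes>\<^sub>M P)"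
    by (intro borel_measurable_uminus measurable_compose[OF _ ev] measurable_compose[OF _ DH] glue_measurable t)
  then show ?thesis by (simp add: fbm_def[abs_def])
qed

lemma pair_measurable: "(\<lambda>z. (snd (fst z), snd z)) \<in> \<mu>B \<Otimes>\<^sub>M P \<rightarrow>\<^sub>M PB \<Otimes>\<^sub>M P"
  by (intro measurable_Pair measurable_compose[OF measurable_fst snd_measurable_\<mu>B] measurable_snd)

lemma \<Phi>_measurable:
  assumes t: "0 \<le> t"
  shows "(\<lambda>z. \<Phi> t (snd (fst z), snd z) (fst (fst z))) \<in> borel_measurable (\<mu>B \<Otimes>\<^sub>M P)"
proof -
  have mX: "(\<lambda>z. fst (fst z)) \<in> borel_measurable (\<mu>B \<Otimes>\<^sub>M P)"
    by (rule measurable_compose[OF measurable_fst fst_measurable_\<mu>B])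
  have sp: "snd (fst z) \<in> path_space H" "snd z \<in> path_space H" if "z \<in> space (\<mu>B \<Otimes>\<^sub>M P)" for z
    using that by (auto simp: space_pair_measure space_\<mu>B space_P intro: Bt_path_space)
  show ?thesis
  proof (cases "t = 0")
    case True
    then show ?thesis using mX sp by (subst measurable_cong[of _ _ "\<lambda>z. fst (fst z)"]) (auto simp: \<Phi>_0)
  next
    case False
    have mB: "(\<lambda>z. \<sigma> *v fbm DH s (snd (fst z), snd z)) \<in> borel_measurable (\<mu>B \<Otimes>\<^sub>M P)" if s: "0 \<le> s" for s
    proof -
      have "(\<lambda>x. \<sigma> *v x) \<in> borel_measurable borel"
        by (intro borel_measurable_continuous_onI linear_continuous_on matrix_vector_mul_bounded_linear)
      then show ?thesis
        by (rule measurable_compose[OF measurable_compose[OF pair_measurable fbm_measurable[OF s]]])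
    qed
    have "integral_solution F (\<lambda>s. \<sigma> *v fbm DH s (snd (fst z), snd z)) (fst (fst z)) t
        (\<lambda>s. \<Phi> s (snd (fst z), snd z) (fst (fst z)))" if "z \<in> space (\<mu>B \<Otimes>\<^sub>M P)" for z
      using sp[OF that] by (rule \<Phi>_integral_solution)
    from integral_solution_measurable[OF F_locally_lipschitz mX mB this] False t
    show ?thesis by simp
  qed
qed

section \<open>Stationarity of the one-step map\<close>

definition "step t z = (\<Phi> t (snd (fst z), snd z) (fst (fst z)), glue t (snd (fst z), snd z))"

lemma step_measurable:
  assumes t: "0 \<le> t"
  shows "step t \<in> \<mu>B \<Otimes>\<^sub>M P \<rightarrow>\<^sub>M \<mu>B"
  unfolding \<mu>B_def
proof (rule measurable_restrict_space2)
  show "step t \<in> space (restrict_space \<mu> (UNIV \<times> Bt) \<Otimes>\<^sub>M P) \<rightarrow> UNIV \<times> Bt"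
    using t unfolding \<mu>B_def[symmetric] by (auto simp: space_pair_measure space_\<mu>B space_P step_def intro: glue_Bt)
  have "step t \<in> \<mu>B \<Otimes>\<^sub>M P \<rightarrow>\<^sub>M borel \<Otimes>\<^sub>M P"
    unfolding step_def[abs_def]
    by (intro measurable_Pair \<Phi>_measurable measurable_compose[OF pair_measurable glue_measurable] t)
  then show "step t \<in> restrict_space \<mu> (UNIV \<times> Bt) \<Otimes>\<^sub>M P \<rightarrow>\<^sub>M \<mu>"
    unfolding \<mu>B_def[symmetric] using measurable_cong_sets[OF refl sets_\<mu>] by blast
qed

text \<open>\<open>step t\<close> realizes the transition kernel as a map driven by an independent
  future path. Fubini reduces the claim to the invariance of \<mu>; \<open>cocycle_glue\<close>
  replaces the cocycle in the kernel by \<open>\<Phi>\<close> for pasts in \<open>Bt\<close>, which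
  carry all the mass.\<close>

lemma distr_step:
  assumes t: "0 < t"
  shows "distr (\<mu>B \<Otimes>\<^sub>M P) \<mu>B (step t) = \<mu>B"
proof (rule measure_eqI)
  interpret P: prob_space P by (rule prob_space_P)
  fix \<Gamma> assume "\<Gamma> \<in> sets (distr (\<mu>B \<Otimes>\<^sub>M P) \<mu>B (step t))"
  then have \<Gamma>: "\<Gamma> \<in> sets \<mu>B" by simp
  then have \<Gamma>': "\<Gamma> \<in> sets \<mu>" using sets_\<mu>B by blast
  have st: "step t \<in> \<mu>B \<Otimes>\<^sub>M P \<rightarrow>\<^sub>M \<mu>B" using t by (intro step_measurable) auto
  have "emeasure (distr (\<mu>B \<Otimes>\<^sub>M P) \<mu>B (step t)) \<Gamma> = (\<integral>\<^sup>+ y. indicator \<Gamma> y \<partial>distr (\<mu>B \<Otimes>\<^sub>M P) \<mu>B (step t))"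
    using \<Gamma> by simp
  also have "\<dots> = (\<integral>\<^sup>+ y. indicator \<Gamma> (step t y) \<partial>(\<mu>B \<Otimes>\<^sub>M P))"
    by (rule nn_integral_distr[OF st]) (use \<Gamma> in simp)
  also have "\<dots> = (\<integral>\<^sup>+ z. \<integral>\<^sup>+ w. indicator \<Gamma> (step t (z, w)) \<partial>P \<partial>\<mu>B)"
    using \<Gamma> st by (intro P.nn_integral_fst[symmetric] measurable_compose[OF st]) simp
  also have "\<dots> = (\<integral>\<^sup>+ z. transition_prob P \<Phi> t z \<Gamma> \<partial>\<mu>B)"
  proof (intro nn_integral_cong)
    fix z assume z: "z \<in> space \<mu>B"
    then have "transition_prob P \<Phi> t z \<Gamma> = (\<integral>\<^sup>+ w. indicator \<Gamma> (step t (z, w)) \<partial>P)"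
      unfolding transition_prob_def case_prod_beta step_def using t
      by (intro nn_integral_cong) (auto simp: space_\<mu>B space_P cocycle_glue)
    then show "(\<integral>\<^sup>+ w. indicator \<Gamma> (step t (z, w)) \<partial>P) = transition_prob P \<Phi> t z \<Gamma>" by simp
  qed
  also have "\<dots> = (\<integral>\<^sup>+ z. transition_prob P \<Phi> t z \<Gamma> * indicator (UNIV \<times> Bt) z \<partial>\<mu>)"
    unfolding \<mu>B_def using sets_UNIV_Bt by (intro nn_integral_restrict_space) auto
  also have "\<dots> = (\<integral>\<^sup>+ z. transition_prob P \<Phi> t z \<Gamma> \<partial>\<mu>)"
    using AE_\<mu>_Bt by (intro nn_integral_cong_AE) (auto elim!: eventually_mono simp: indicator_def)
  also have "\<dots> = emeasure \<mu> \<Gamma>"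
    using invariant t \<Gamma>' by (simp add: invariant_measure_def)
  finally show "emeasure (distr (\<mu>B \<Otimes>\<^sub>M P) \<mu>B (step t)) \<Gamma> = emeasure \<mu>B \<Gamma>"
    using emeasure_\<mu>B[OF \<Gamma>] by simp
qed simp

text \<open>Read off from the invariance of \<mu>, tested on sets UNIV \<times> A, together with its
  marginal \<open>P\<close>, rather than from a computation with Brownian increments.\<close>

lemma distr_glue:
  assumes t: "0 < t"
  shows "distr (PB \<Otimes>\<^sub>M P) P (glue t) = P"
proof -
  interpret P: prob_space P by (rule prob_space_P)
  have t': "0 \<le> t" using t by simp
  show ?thesis
  proof (rule measure_eqI)
    fix A assume "A \<in> sets (distr (PB \<Otimes>\<^sub>M P) P (glue t))"
    then have A: "A \<in> sets P" by simp
    define f where "f w = (\<integral>\<^sup>+ v. indicator A (glue t (w, v)) \<partial>P)" for w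
    have UA: "UNIV \<times> A \<in> sets \<mu>" unfolding sets_\<mu> using A by (auto intro!: pair_measureI)
    have tp: "transition_prob P \<Phi> t z (UNIV \<times> A) = f (snd z)" for z
      unfolding transition_prob_def f_def case_prod_beta by (intro nn_integral_cong) (auto simp: indicator_def)
    have mA: "(\<lambda>z. indicator A (glue t z) :: ennreal) \<in> borel_measurable (PB \<Otimes>\<^sub>M P)"
      by (rule measurable_compose[OF glue_measurable[OF t']]) (use A in simp)
    have "f \<in> borel_measurable PB" unfolding f_def using mA by (rule P.borel_measurable_nn_integral_fst)
    then have f[measurable]: "(\<lambda>w. f w * indicator Bt w) \<in> borel_measurable P"
      unfolding PB_def using sets_Bt by (subst (asm) borel_measurable_restrict_space_iff_ennreal) auto
    have "emeasure (distr (PB \<Otimes>\<^sub>M P) P (glue t)) A = (\<integral>\<^sup>+ z. indicator A z \<partial>distr (PB \<Otimes>\<^sub>M P) P (glue t))"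
      using A by simp
    also have "\<dots> = (\<integral>\<^sup>+ z. indicator A (glue t z) \<partial>(PB \<Otimes>\<^sub>M P))"
      by (rule nn_integral_distr[OF glue_measurable[OF t']]) (use A in simp)
    also have "\<dots> = (\<integral>\<^sup>+ w. f w \<partial>PB)"
      unfolding f_def using mA by (rule P.nn_integral_fst[symmetric])
    also have "\<dots> = (\<integral>\<^sup>+ w. f w * indicator Bt w \<partial>P)"
      unfolding PB_def using sets_Bt by (intro nn_integral_restrict_space) auto
    also have "\<dots> = (\<integral>\<^sup>+ w. f w * indicator Bt w \<partial>distr \<mu> P snd)" by (simp add: snd_\<mu>)
    also have "\<dots> = (\<integral>\<^sup>+ z. f (snd z) * indicator Bt (snd z) \<partial>\<mu>)"
      by (rule nn_integral_distr[OF snd_measurable_\<mu>]) simp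
    also have "\<dots> = (\<integral>\<^sup>+ z. transition_prob P \<Phi> t z (UNIV \<times> A) \<partial>\<mu>)"
      unfolding tp using AE_\<mu>_Bt by (intro nn_integral_cong_AE) (auto elim!: eventually_mono)
    also have "\<dots> = emeasure \<mu> (UNIV \<times> A)"
      using invariant t' UA by (simp add: invariant_measure_def)
    also have "\<dots> = emeasure (distr \<mu> P snd) A"
      using A sets.sets_into_space[OF A] snd_measurable_\<mu>
      by (subst emeasure_distr) (auto simp: space_\<mu> space_P intro!: arg_cong[where f = "emeasure \<mu>"])
    finally show "emeasure (distr (PB \<Otimes>\<^sub>M P) P (glue t)) A = emeasure P A" by (simp add: snd_\<mu>)
  qed simp
qed

end

section \<open>Synchronization\<close>

text \<open>The diagonal pairs omitted in the definition contribute 0, which is below \<eta>; this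
  also brings the separate value for p = 1 under the same formula.\<close>

lemma support_diameter_less_iff:
  assumes "1 \<le> p" "0 < \<eta>"
  shows "support_diameter p b w < \<eta> \<longleftrightarrow> (\<forall>i\<in>{1..p}. \<forall>j\<in>{1..p}. norm (b i w - b j w) < \<eta>)"
proof (cases "p = 1")
  case True
  then show ?thesis using assms by (simp add: support_diameter_def)
next
  case False
  define D where "D = {norm (b i w - b j w) | i j. i \<in> {1..p} \<and> j \<in> {1..p} \<and> i \<noteq> j}"
  have "D \<subseteq> (\<lambda>(i, j). norm (b i w - b j w)) ` ({1..p} \<times> {1..p})" by (auto simp: D_def)
  then have "finite D" by (rule finite_subset) auto
  moreover have "norm (b 1 w - b 2 w) \<in> D" 
    unfolding D_def using assms False by (intro CollectI exI[of _ 1] exI[of _ 2]) auto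
  ultimately have "Max D < \<eta> \<longleftrightarrow> (\<forall>x\<in>D. x < \<eta>)" by (subst Max_less_iff) auto
  also have "\<dots> \<longleftrightarrow> (\<forall>i\<in>{1..p}. \<forall>j\<in>{1..p}. norm (b i w - b j w) < \<eta>)"
  proof (intro iffI ballI)
    fix i j assume *: "\<forall>x\<in>D. x < \<eta>" "i \<in> {1..p}" "j \<in> {1..p}"
    show "norm (b i w - b j w) < \<eta>"
    proof (cases "i = j")
      case False
      then have "norm (b i w - b j w) \<in> D" unfolding D_def using * by blast
      then show ?thesis using * by blast
    qed (use assms in simp)
  qed (auto simp: D_def)
  finally show ?thesis using False by (simp add: support_diameter_def D_def)
qed

lemma norm_le_support_diameter:
  assumes "1 \<le> p" "0 \<le> C" "support_diameter p b w \<le> C" "i \<in> {1..p}" "j \<in> {1..p}"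
  shows "norm (b i w - b j w) \<le> C"
proof (rule field_le_epsilon)
  fix e :: real assume "0 < e"
  then have "support_diameter p b w < C + e" "0 < C + e" using assms(2,3) by auto
  then show "norm (b i w - b j w) \<le> C + e"
    using support_diameter_less_iff[OF assms(1), of "C + e" b w] assms(4,5) by (auto intro: less_imp_le)
qed

locale finitely_supported_sde = noisy_sde H \<alpha> C1 C2 C3 CF N P DH F \<sigma> \<Phi> \<mu> Bt \<kappa>
  for H \<alpha> C1 C2 C3 CF :: real and N :: nat and P :: "('n::finite) path measure"
    and DH F \<sigma> \<Phi> \<mu> Bt \<kappa> +
  fixes C4 R C :: real and p :: nat and b :: "nat \<Rightarrow> 'n path \<Rightarrow> real ^ 'n"
  assumes monotone: "eventually_strictly_monotone F R C4"
    and finite_support: "finite_support_condition P Bt \<kappa> p b C"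
begin

lemma p_pos: "1 \<le> p" and C_pos: "0 < C" and C4_pos: "0 < C4"
  using monotone finite_support by (auto simp: eventually_strictly_monotone_def finite_support_condition_def)

lemma b_measurable: "i \<in> {1..p} \<Longrightarrow> b i \<in> borel_measurable PB"
  using finite_support by (auto simp: finite_support_condition_def PB_def)

text \<open>Labels may coincide, so \<open>p\<close> is only an upper bound for the number of
  points.\<close>

definition "points w = (\<lambda>i. b i w) ` {1..p}"

lemma measure_support_\<kappa>: "w \<in> Bt \<Longrightarrow> measure_support (\<kappa> w) = points w"
  using finite_support by (auto simp: finite_support_condition_def points_def)

lemma finite_points: "finite (points w)"
  by (simp add: points_def)

lemma points_diameter: "w \<in> Bt \<Longrightarrow> x \<in> points w \<Longrightarrow> y \<in> points w \<Longrightarrow> norm (x - y) \<le> C"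
  using finite_support norm_le_support_diameter[OF p_pos, of C b w] C_pos
  by (auto simp: finite_support_condition_def points_def)

text \<open>An equality of sets only: nothing ties the label of a point after the step to its label
  before. Later quantities are therefore symmetric in the labels.\<close>

lemma points_glue:
  assumes "v \<in> Bt" "w \<in> path_space H" "0 \<le> t"
  shows "points (glue t (v, w)) = \<Phi> t (v, w) ` points v"
  using measure_support_glue[OF assms] measure_support_\<kappa>[OF assms(1)] measure_support_\<kappa>[OF glue_Bt[OF assms]]
  by (simp add: finite_points)

text \<open>A point outside the larger ball forces the other points of the support, which are at distance
  at most \<open>C\<close>, out of the ball of radius \<open>R\<close>.\<close>

lemma \<Phi>_contraction:
  assumes v: "v \<in> Bt" and w: "w \<in> path_space H" and d: "0 \<le> d" and x: "x \<in> points v" and y: "y \<in> points v"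
    and out: "\<And>s. s \<in> {0..d} \<Longrightarrow> R + C < norm (\<Phi> s (v, w) x)"
  shows "norm (\<Phi> d (v, w) x - \<Phi> d (v, w) y) \<le> norm (x - y) * exp (- C4 * d)"
proof (rule solution_difference[OF d F_continuous \<Phi>_integral_solution[OF Bt_path_space[OF v] w] \<Phi>_integral_solution[OF Bt_path_space[OF v] w]])
  fix s assume s: "0 < s" "s < d"
  define X Y where "X = \<Phi> s (v, w) x" and "Y = \<Phi> s (v, w) y"
  have "glue s (v, w) \<in> Bt" "X \<in> points (glue s (v, w))" "Y \<in> points (glue s (v, w))"
    using s x y by (auto simp: points_glue[OF v w] X_def Y_def intro: glue_Bt[OF v w])
  then have "norm (X - Y) \<le> C" by (rule points_diameter)
  moreover have "R + C < norm X" using out[of s] s by (simp add: X_def)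
  moreover have "norm X - norm Y \<le> norm (X - Y)" by (rule norm_triangle_ineq2)
  ultimately have "R \<le> norm X" "R \<le> norm Y" using C_pos by linarith+
  then show "(F X - F Y) \<bullet> (X - Y) \<le> - C4 * (norm (X - Y))\<^sup>2"
    using monotone by (simp add: eventually_strictly_monotone_def)
qed

text \<open>Taken over labels rather than over \<open>points\<close>, this is a maximum of a fixed
  finite family of measurable functions.\<close>

definition "reach z = Max ((\<lambda>i. norm (fst z - b i (snd z))) ` {1..p})"

lemma reach_le_iff: "reach z \<le> c \<longleftrightarrow> (\<forall>y\<in>points (snd z). norm (fst z - y) \<le> c)"
  unfolding reach_def points_def using p_pos by (subst Max_le_iff) auto

lemma reach_ge: "y \<in> points (snd z) \<Longrightarrow> norm (fst z - y) \<le> reach z"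
  using reach_le_iff[of z "reach z"] by simp

lemma reach_measurable: "reach \<in> borel_measurable \<mu>B"
  unfolding reach_def
proof (rule borel_measurable_Max)
  fix i assume i: "i \<in> {1..p}"
  have [measurable]: "(\<lambda>z. b i (snd z)) \<in> borel_measurable \<mu>B" "fst \<in> borel_measurable \<mu>B"
    using measurable_compose[OF snd_measurable_\<mu>B b_measurable[OF i]] fst_measurable_\<mu>B by auto
  show "(\<lambda>z. norm (fst z - b i (snd z))) \<in> borel_measurable \<mu>B" by measurable
qed simp

text \<open>The ball is closed, so outside the event the norm stays strictly above R + C. Time 0 is
  included, so as d decreases to 0 the events shrink to that of starting in the ball.\<close>

definition "hit d = {z \<in> space (\<mu>B \<Otimes>\<^sub>M P). \<exists>s\<in>{0..d}. norm (\<Phi> s (snd (fst z), snd z) (fst (fst z))) \<le> R + C}"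

lemma space_\<mu>B_P: "z \<in> space (\<mu>B \<Otimes>\<^sub>M P) \<longleftrightarrow> snd (fst z) \<in> Bt \<and> snd z \<in> path_space H"
  by (cases z) (auto simp: space_pair_measure space_\<mu>B space_P)

text \<open>Every support point after the step is the image of one before it, so pairwise estimates
  pass to the maximum. The second bound needs x in the support, because the diameter bound C is what
  keeps the other points away from the ball of radius R.\<close>

lemma reach_step:
  assumes z: "z \<in> space (\<mu>B \<Otimes>\<^sub>M P)" and d: "0 \<le> d"
  shows "reach (step d z) \<le> reach (fst z) * exp (C3 * d)"
    and "z \<notin> hit d \<Longrightarrow> fst (fst z) \<in> points (snd (fst z)) \<Longrightarrow> reach (step d z) \<le> reach (fst z) * exp (- C4 * d)"
proof -
  obtain x v w where zeq: "z = ((x, v), w)" by (metis surj_pair)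
  have v: "v \<in> Bt" and w: "w \<in> path_space H" using z by (auto simp: zeq space_\<mu>B_P)
  have le: "norm (x - y) * exp c \<le> reach (x, v) * exp c" if "y \<in> points v" for y c
    using reach_ge[of y "(x, v)"] that by (intro mult_right_mono) auto
  have reach_step_le: "reach (step d z) \<le> reach (fst z) * exp c"
    if "\<And>y. y \<in> points v \<Longrightarrow> norm (\<Phi> d (v, w) x - \<Phi> d (v, w) y) \<le> norm (x - y) * exp c" for c
    unfolding reach_le_iff
  proof
    fix y assume "y \<in> points (snd (step d z))"
    then obtain y' where "y' \<in> points v" "y = \<Phi> d (v, w) y'"
      using points_glue[OF v w d] by (auto simp: step_def zeq)
    then show "norm (fst (step d z) - y) \<le> reach (fst z) * exp c"
      using order_trans[OF that le[of y' c]] by (simp add: step_def zeq)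
  qed
  show "reach (step d z) \<le> reach (fst z) * exp (C3 * d)"
    by (rule reach_step_le) (rule \<Phi>_lipschitz[OF Bt_path_space[OF v] w d])
  assume "z \<notin> hit d" "fst (fst z) \<in> points (snd (fst z))"
  then show "reach (step d z) \<le> reach (fst z) * exp (- C4 * d)"
    using z by (intro reach_step_le \<Phi>_contraction[OF v w d]) (auto simp: zeq hit_def not_le)
qed

text \<open>For a basic open set \<open>U\<close>, the pasts whose support misses \<open>U\<close>
  give it \<kappa>-mass 0, so the disintegration formula makes the corresponding product set null. A
  countable basis gathers all exceptions into one null set.\<close>

lemma AE_points: "AE z in \<mu>B. fst z \<in> points (snd z)"
proof -
  obtain \<D> :: "(real ^ 'n) set set" where D: "countable \<D>" "topological_basis \<D>"
    using ex_countable_basis by blast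
  have "AE z in \<mu>B. \<forall>U\<in>\<D>. \<not> (fst z \<in> U \<and> points (snd z) \<inter> U = {})"
  proof (rule AE_ball_countable'[OF _ D(1)])
    fix U assume "U \<in> \<D>"
    then have U: "open U" using D(2) topological_basis_open by blast
    define V where "V = {w \<in> Bt. points w \<inter> U = {}}"
    have "V = {w \<in> space PB. \<forall>i\<in>{1..p}. b i w \<notin> U}"
      by (auto simp: V_def space_PB points_def)
    also have "\<dots> \<in> sets PB"
    proof (rule sets.sets_Collect_finite_All')
      fix i assume i: "i \<in> {1..p}"
      have "{w \<in> space PB. b i w \<notin> U} = b i -` (- U) \<inter> space PB" by auto
      also have "\<dots> \<in> sets PB" using U by (intro measurable_sets[OF b_measurable[OF i]]) auto
      finally show "{w \<in> space PB. b i w \<notin> U} \<in> sets PB" .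
    qed (use p_pos in auto)
    finally have V: "V \<in> sets P" using sets_PB by blast
    have UV: "U \<times> V \<in> sets \<mu>" unfolding sets_\<mu> using U V by (auto intro!: pair_measureI)
    have "emeasure \<mu> (U \<times> V) = (\<integral>\<^sup>+ w\<in>V. emeasure (\<kappa> w) U \<partial>P)"
      using disint U V by (simp add: disintegration_def)
    also have "\<dots> = (\<integral>\<^sup>+ w. 0 \<partial>P)"
    proof (rule nn_integral_cong)
      fix w
      show "emeasure (\<kappa> w) U * indicator V w = 0"
      proof (cases "w \<in> V")
        case True
        then have "emeasure (\<kappa> w) U = 0"
          by (intro emeasure_disjoint_support sets_\<kappa> U) (auto simp: V_def measure_support_\<kappa>)
        then show ?thesis by simp
      qed simp
    qed
    finally have "emeasure \<mu>B (U \<times> V) = 0"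
      using UV by (subst emeasure_\<mu>B) (auto simp: sets_\<mu>B V_def)
    moreover have "U \<times> V \<in> sets \<mu>B" using UV by (auto simp: sets_\<mu>B V_def)
    ultimately show "AE z in \<mu>B. \<not> (fst z \<in> U \<and> points (snd z) \<inter> U = {})"
      by (intro AE_I[of _ _ "U \<times> V"]) (auto simp: V_def space_\<mu>B)
  qed
  then show ?thesis
  proof (rule eventually_mono)
    fix z assume *: "\<forall>U\<in>\<D>. \<not> (fst z \<in> U \<and> points (snd z) \<inter> U = {})"
    show "fst z \<in> points (snd z)"
    proof (rule ccontr)
      assume "fst z \<notin> points (snd z)"
      moreover have "open (- points (snd z))" by (intro open_Compl finite_imp_closed finite_points)
      ultimately obtain U where "U \<in> \<D>" "fst z \<in> U" "U \<subseteq> - points (snd z)"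
        using topological_basisE[OF D(2), of "- points (snd z)" "fst z"] by auto
      then show False using * by blast
    qed
  qed
qed

text \<open>The minimum of a continuous function over the window is attained; hence the closed ball
  is met if and only if, for every k, the norm falls below R + C + 1 / (k + 1) at some rational
  time.\<close>

lemma hit_sets:
  assumes d: "0 < d"
  shows "hit d \<in> sets (\<mu>B \<Otimes>\<^sub>M P)"
proof -
  define Y where "Y s z = norm (\<Phi> s (snd (fst z), snd z) (fst (fst z)))" for s and z :: "((real ^ 'n) \<times> 'n path) \<times> 'n path"
  define Q where "Q = \<rat> \<inter> {0..d}"
  have Q: "countable Q" unfolding Q_def using countable_rat by blast
  have cont: "continuous_on {0..d} (\<lambda>s. Y s z)" if "z \<in> space (\<mu>B \<Otimes>\<^sub>M P)" for z
    using that Bt_path_space unfolding Y_def space_\<mu>B_P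
    by (intro continuous_on_norm \<Phi>_continuous_time) auto
  have Y: "Y s \<in> borel_measurable (\<mu>B \<Otimes>\<^sub>M P)" if "s \<in> Q" for s
    using that unfolding Y_def 
    by (intro measurable_compose[OF \<Phi>_measurable borel_measurable_norm]) (auto simp: Q_def)
  have "(\<exists>s\<in>{0..d}. Y s z \<le> R + C) \<longleftrightarrow> (\<forall>k. \<exists>q\<in>Q. Y q z < R + C + 1 / real (Suc k))"
    if z: "z \<in> space (\<mu>B \<Otimes>\<^sub>M P)" for z
  proof
    assume "\<exists>s\<in>{0..d}. Y s z \<le> R + C"
    then obtain s where s: "s \<in> {0..d}" "Y s z \<le> R + C" by blast
    show "\<forall>k. \<exists>q\<in>Q. Y q z < R + C + 1 / real (Suc k)"
    proof
      fix k
      have e: "0 < 1 / real (Suc k)" by simp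
      then obtain r where r: "r > 0" "\<And>q. q \<in> {0..d} \<Longrightarrow> dist q s < r \<Longrightarrow> dist (Y q z) (Y s z) < 1 / real (Suc k)"
        using cont[OF z] s(1) unfolding continuous_on_iff by meson
      \<comment> \<open>The window has positive length, so a neighbourhood of \<open>s\<close> meets
        it in an open interval even when \<open>s\<close> is an endpoint.\<close>
      have "max 0 (s - r) < min d (s + r)" using s(1) r(1) d by auto
      then obtain q where q: "q \<in> \<rat>" "max 0 (s - r) < q" "q < min d (s + r)" using Rats_dense_in_real by blast
      then have "dist (Y q z) (Y s z) < 1 / real (Suc k)" by (intro r(2)) (auto simp: dist_real_def)
      then have "Y q z < R + C + 1 / real (Suc k)" using s(2) unfolding dist_real_def by linarith
      then show "\<exists>q\<in>Q. Y q z < R + C + 1 / real (Suc k)" using q by (intro bexI[of _ q]) (auto simp: Q_def)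
    qed
  next
    assume *: "\<forall>k. \<exists>q\<in>Q. Y q z < R + C + 1 / real (Suc k)"
    obtain s where s: "s \<in> {0..d}" "\<And>q. q \<in> {0..d} \<Longrightarrow> Y s z \<le> Y q z"
      using continuous_attains_inf[OF _ _ cont[OF z]] d by auto
    have "Y s z \<le> R + C"
    proof (rule field_le_epsilon)
      fix e :: real assume "0 < e"
      then obtain k where k: "1 / real (Suc k) < e" using nat_approx_posE by blast
      obtain q where "q \<in> Q" "Y q z < R + C + 1 / real (Suc k)" using * by blast
      then show "Y s z \<le> R + C + e" using s(2)[of q] k by (auto simp: Q_def)
    qed
    then show "\<exists>s\<in>{0..d}. Y s z \<le> R + C" using s(1) by blast
  qed
  then have "hit d = {z \<in> space (\<mu>B \<Otimes>\<^sub>M P). \<forall>k. \<exists>q\<in>Q. Y q z < R + C + 1 / real (Suc k)}"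
    unfolding hit_def Y_def by blast
  also have "\<dots> \<in> sets (\<mu>B \<Otimes>\<^sub>M P)"
    using Y by (intro sets.sets_Collect_countable_All sets.sets_Collect_countable_Ex'[OF _ Q] borel_measurable_less) auto
  finally show ?thesis .
qed

definition "synchronized = {w \<in> Bt. \<forall>i\<in>{1..p}. b i w = b 1 w}"

lemma synchronized_sets: "synchronized \<in> sets PB"
proof -
  have "{w \<in> space PB. \<forall>i\<in>{1..p}. b i w = b 1 w} \<in> sets PB"
  proof (rule sets.sets_Collect_finite_All')
    fix i assume i: "i \<in> {1..p}"
    have [measurable]: "b i \<in> borel_measurable PB" "b 1 \<in> borel_measurable PB"
      using b_measurable i p_pos by auto
    show "{w \<in> space PB. b i w = b 1 w} \<in> sets PB" by measurable
  qed (use p_pos in auto)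
  then show ?thesis by (simp add: synchronized_def space_PB)
qed

lemma synchronizedD:
  assumes "w \<in> synchronized"
  shows "w \<in> Bt" and "i \<in> {1..p} \<Longrightarrow> j \<in> {1..p} \<Longrightarrow> b i w = b j w"
proof -
  show "w \<in> Bt" using assms by (simp add: synchronized_def)
  have "b i w = b 1 w" if "i \<in> {1..p}" for i
    using assms that unfolding synchronized_def by blast
  then show "i \<in> {1..p} \<Longrightarrow> j \<in> {1..p} \<Longrightarrow> b i w = b j w" by metis
qed

lemma points_synchronized:
  assumes "w \<in> synchronized"
  shows "points w = {b 1 w}"
proof -
  have "points w = (\<lambda>i. b 1 w) ` {1..p}"
    unfolding points_def using p_pos by (intro image_cong synchronizedD(2)[OF assms]) auto
  then show ?thesis using p_pos by (simp add: image_constant_conv)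
qed

text \<open>If all support points are at distance 0 from x, they coincide. Off
  \<open>synchronized\<close> the logarithm of \<open>reach\<close> is therefore a genuine
  value.\<close>

lemma reach_pos: "snd z \<in> Bt \<Longrightarrow> snd z \<notin> synchronized \<Longrightarrow> 0 < reach z"
proof (rule ccontr)
  assume z: "snd z \<in> Bt" "snd z \<notin> synchronized" and "\<not> 0 < reach z"
  then have "\<forall>y\<in>points (snd z). norm (fst z - y) \<le> 0" unfolding reach_le_iff[symmetric] by simp
  then have "b i (snd z) = fst z" if "i \<in> {1..p}" for i using that by (auto simp: points_def)
  then show False using z p_pos by (auto simp: synchronized_def)
qed

text \<open>\<open>stationary_drift\<close> on \<open>\<mu>B \<Otimes>\<^sub>M P\<close>, applied to
  the logarithm of \<open>reach\<close> after and before the step, with a = C3 * d and b = C4 * d.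
  Both rates are proportional to d, so the resulting bound does not depend on the window.\<close>

lemma hit_prob:
  assumes ns: "AE w in P. w \<notin> synchronized" and d: "0 < d"
  shows "C4 / (C3 + C4) \<le> measure (\<mu>B \<Otimes>\<^sub>M P) (hit d)"
proof -
  interpret B: prob_space \<mu>B by (rule prob_space_\<mu>B)
  interpret P: prob_space P by (rule prob_space_P)
  interpret M: pair_prob_space \<mu>B P ..
  have st: "step d \<in> \<mu>B \<Otimes>\<^sub>M P \<rightarrow>\<^sub>M \<mu>B" using d by (intro step_measurable) auto
  have lnr: "(\<lambda>z. ln (reach z)) \<in> borel_measurable \<mu>B"
    using reach_measurable by (rule borel_measurable_ln)
  have pos: "AE z in \<mu>B. 0 < reach z"
  proof -
    have "AE z in \<mu>B. snd z \<notin> synchronized" by (rule AE_\<mu>B_I) (use ns in \<open>auto elim: eventually_mono\<close>)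
    with AE_space show ?thesis
      by eventually_elim (auto simp: space_\<mu>B intro: reach_pos)
  qed
  have pos1: "AE z in \<mu>B \<Otimes>\<^sub>M P. 0 < reach (fst z)"
  proof -
    have "AE z in distr (\<mu>B \<Otimes>\<^sub>M P) \<mu>B fst. 0 < reach z"
      using pos by (subst distr_fst_pair[OF prob_space_P])
    then show ?thesis by (rule AE_distrD[OF measurable_fst])
  qed
  have supp: "AE z in \<mu>B \<Otimes>\<^sub>M P. fst (fst z) \<in> points (snd (fst z))"
  proof -
    have "AE z in distr (\<mu>B \<Otimes>\<^sub>M P) \<mu>B fst. fst z \<in> points (snd z)"
      using AE_points by (subst distr_fst_pair[OF prob_space_P])
    then show ?thesis by (rule AE_distrD[OF measurable_fst])
  qed
  have pos2: "AE z in \<mu>B \<Otimes>\<^sub>M P. 0 < reach (step d z)"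
  proof -
    have "AE z in distr (\<mu>B \<Otimes>\<^sub>M P) \<mu>B (step d). 0 < reach z"
      using pos by (subst distr_step[OF d])
    then show ?thesis by (rule AE_distrD[OF st])
  qed
  have ln_le: "ln r \<le> ln s + c" if "0 < r" "0 < s" "r \<le> s * exp c" for r s c :: real
  proof -
    have "ln r \<le> ln (s * exp c)" using that by (subst ln_le_cancel_iff) auto
    then show ?thesis using that by (simp add: ln_mult)
  qed
  have "(C4 * d) * (1 - M.prob (hit d)) \<le> (C3 * d) * M.prob (hit d)"
  proof (rule M.stationary_drift)
    show "(\<lambda>z. ln (reach (step d z))) \<in> borel_measurable (\<mu>B \<Otimes>\<^sub>M P)"
      "(\<lambda>z. ln (reach (fst z))) \<in> borel_measurable (\<mu>B \<Otimes>\<^sub>M P)"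
      by (rule measurable_compose[OF st lnr], rule measurable_compose[OF measurable_fst lnr])
    have "distr (\<mu>B \<Otimes>\<^sub>M P) borel (\<lambda>z. ln (reach (step d z))) = 
        distr (distr (\<mu>B \<Otimes>\<^sub>M P) \<mu>B (step d)) borel (\<lambda>z. ln (reach z))"
      by (subst distr_distr[OF lnr st]) (simp add: comp_def)
    also have "\<dots> = distr (distr (\<mu>B \<Otimes>\<^sub>M P) \<mu>B fst) borel (\<lambda>z. ln (reach z))"
      by (simp add: distr_step[OF d] distr_fst_pair[OF prob_space_P])
    also have "\<dots> = distr (\<mu>B \<Otimes>\<^sub>M P) borel (\<lambda>z. ln (reach (fst z)))"
      by (subst distr_distr[OF lnr measurable_fst]) (simp add: comp_def)
    finally show "distr (\<mu>B \<Otimes>\<^sub>M P) borel (\<lambda>z. ln (reach (step d z))) = 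
      distr (\<mu>B \<Otimes>\<^sub>M P) borel (\<lambda>z. ln (reach (fst z)))" .
    show "AE z in \<mu>B \<Otimes>\<^sub>M P. ln (reach (step d z)) \<le> ln (reach (fst z)) + C3 * d"
      using pos1 pos2 AE_space
    proof eventually_elim
      case (elim z)
      then show ?case using reach_step(1)[of z d] d by (intro ln_le) auto
    qed
    show "AE z in \<mu>B \<Otimes>\<^sub>M P. z \<notin> hit d \<longrightarrow> ln (reach (step d z)) \<le> ln (reach (fst z)) - C4 * d"
      using pos1 pos2 supp AE_space
    proof eventually_elim
      case (elim z)
      show ?case
      proof
        assume "z \<notin> hit d"
        then have "ln (reach (step d z)) \<le> ln (reach (fst z)) + - C4 * d"
          using elim reach_step(2)[of z d] d by (intro ln_le) auto
        then show "ln (reach (step d z)) \<le> ln (reach (fst z)) - C4 * d" by simp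
      qed
    qed
  qed (use d C3_pos C4_pos hit_sets[OF d] in auto)
  then have "d * (C4 * (1 - M.prob (hit d))) \<le> d * (C3 * M.prob (hit d))" by (simp add: mult_ac)
  then have "C4 * (1 - M.prob (hit d)) \<le> C3 * M.prob (hit d)" using d by simp
  then have "C4 \<le> M.prob (hit d) * (C3 + C4)" by (simp add: algebra_simps)
  then show ?thesis using C3_pos C4_pos by (simp add: pos_divide_le_eq)
qed

text \<open>Being uniform in d, the bound of \<open>hit_prob\<close> survives the decreasing
  intersection over d = 1 / (n + 1). On it the hitting times tend to 0, and continuity together with
  \<open>\<Phi>_0\<close> puts the starting point into the closed ball.\<close>

lemma ball_prob:
  assumes ns: "AE w in P. w \<notin> synchronized"
  shows "C4 / (C3 + C4) \<le> measure (distr \<mu> borel fst) (cball 0 (R + C))"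
proof -
  interpret B: prob_space \<mu>B by (rule prob_space_\<mu>B)
  interpret P: prob_space P by (rule prob_space_P)
  interpret M: pair_prob_space \<mu>B P ..
  define A where "A n = hit (1 / real (Suc n))" for n
  have "(\<lambda>n. measure (\<mu>B \<Otimes>\<^sub>M P) (A n)) \<longlonglongrightarrow> measure (\<mu>B \<Otimes>\<^sub>M P) (\<Inter>n. A n)"
  proof (rule M.finite_Lim_measure_decseq)
    show "range A \<subseteq> sets (\<mu>B \<Otimes>\<^sub>M P)" by (auto simp: A_def intro!: hit_sets)
    show "decseq A"
    proof (rule decseq_SucI)
      fix n
      have "1 / real (Suc (Suc n)) \<le> 1 / real (Suc n)" by (simp add: frac_le)
      then show "A (Suc n) \<subseteq> A n" unfolding A_def hit_def by fastforce
    qed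
  qed
  then have "C4 / (C3 + C4) \<le> measure (\<mu>B \<Otimes>\<^sub>M P) (\<Inter>n. A n)"
    by (rule LIMSEQ_le_const) (auto simp: A_def intro!: hit_prob[OF ns])
  also have "(\<Inter>n. A n) \<subseteq> (cball 0 (R + C) \<times> Bt) \<times> space P"
  proof
    fix z assume z: "z \<in> (\<Inter>n. A n)"
    obtain x v w where zeq: "z = ((x, v), w)" by (metis surj_pair)
    have vw: "v \<in> Bt" "v \<in> path_space H" "w \<in> path_space H"
      using z Bt_path_space by (auto simp: A_def hit_def space_\<mu>B_P zeq)
    define y where "y s = norm (\<Phi> s (v, w) x)" for s
    have "\<forall>n. \<exists>s\<in>{0..1 / real (Suc n)}. y s \<le> R + C" using z by (auto simp: A_def hit_def zeq y_def)
    then obtain s where s: "\<And>n. s n \<in> {0..1 / real (Suc n)}" "\<And>n. y (s n) \<le> R + C" by metis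
    have lim: "s \<longlonglongrightarrow> 0"
    proof (rule tendsto_sandwich[OF _ _ tendsto_const])
      show "(\<lambda>n. 1 / real (Suc n)) \<longlonglongrightarrow> 0"
        using LIMSEQ_inverse_real_of_nat by (simp add: inverse_eq_divide)
    qed (use s(1) in auto)
    have cont: "continuous_on {0..1} y"
      unfolding y_def using vw by (intro continuous_on_norm \<Phi>_continuous_time) auto
    have s01: "s n \<in> {0..1}" for n
    proof -
      have "1 / real (Suc n) \<le> 1" by simp
      then show ?thesis using s(1)[of n] unfolding atLeastAtMost_iff by linarith
    qed
    have "(\<lambda>n. y (s n)) \<longlonglongrightarrow> y 0"
      by (rule continuous_on_tendsto_compose[OF cont lim]) (simp_all add: s01[unfolded atLeastAtMost_iff])
    then have "y 0 \<le> R + C" by (rule LIMSEQ_le_const2) (use s(2) in blast)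
    then show "z \<in> (cball 0 (R + C) \<times> Bt) \<times> space P"
      using vw by (simp add: y_def \<Phi>_0 zeq space_P)
  qed
  then have "measure (\<mu>B \<Otimes>\<^sub>M P) (\<Inter>n. A n) \<le> measure (\<mu>B \<Otimes>\<^sub>M P) ((cball 0 (R + C) \<times> Bt) \<times> space P)"
    by (intro M.finite_measure_mono) (auto simp: sets_\<mu>B sets_\<mu> intro!: pair_measureI sets_Bt)
  also have "\<dots> = measure \<mu>B (cball 0 (R + C) \<times> Bt)"
    by (subst measure_def, subst P.emeasure_pair_measure_Times)
       (auto simp: sets_\<mu>B sets_\<mu> P.emeasure_space_1 measure_def intro!: pair_measureI sets_Bt)
  also have "\<dots> = measure \<mu> (cball 0 (R + C) \<times> Bt)"
    unfolding measure_def by (subst emeasure_\<mu>B) (auto simp: sets_\<mu>B sets_\<mu> intro!: pair_measureI sets_Bt)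
  also have "\<dots> \<le> measure \<mu> (fst -` cball 0 (R + C) \<inter> space \<mu>)"
    using prob_space_\<mu> fst_measurable_\<mu> Bt_path_space
    by (intro finite_measure.finite_measure_mono prob_space.axioms measurable_sets) (auto simp: space_\<mu>)
  also have "\<dots> = measure (distr \<mu> borel fst) (cball 0 (R + C))"
    by (rule measure_distr[OF fst_measurable_\<mu>, symmetric]) simp
  finally show ?thesis .
qed

section \<open>Zero-one law and conclusion\<close>

lemma synchronized_glue:
  assumes v: "v \<in> synchronized" and w: "w \<in> path_space H" and t: "0 \<le> t"
  shows "glue t (v, w) \<in> synchronized"
proof -
  have v': "v \<in> Bt" using v by (rule synchronizedD)
  have "points (glue t (v, w)) = {\<Phi> t (v, w) (b 1 v)}"
    using points_glue[OF v' w t] points_synchronized[OF v] by simp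
  then have "b i (glue t (v, w)) = \<Phi> t (v, w) (b 1 v)" if "i \<in> {1..p}" for i
    using that by (auto simp: points_def)
  then show ?thesis using glue_Bt[OF v' w t] p_pos by (auto simp: synchronized_def)
qed

lemma synchronized_zero_one: "measure P synchronized = 0 \<or> measure P synchronized = 1"
proof -
  \<comment> \<open>Times n + 1, because \<open>distr_glue\<close> is stated for positive
    times.\<close>
  define K where "K n = (glue (real (Suc n)) :: 'n path \<times> 'n path \<Rightarrow> 'n path)" for n
  \<comment> \<open>Collecting all events that eventually depend on the fresh noise alone, instead
    of finite-dimensional cylinders, makes stability under intersection immediate: the larger of two
    thresholds works. The family contains the evaluation cylinders, hence still generates.\<close>
  define \<E> where "\<E> = {E \<in> sets P. \<exists>n0. \<forall>n\<ge>n0. \<exists>E'\<in>sets P. \<forall>v\<in>space PB. \<forall>w\<in>space P. K n (v, w) \<in> E \<longleftrightarrow> w \<in> E'}"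
  have "evaluations H \<subseteq> \<E>"
  proof
    fix E :: "'n path set" assume ev: "E \<in> evaluations H"
    then obtain s A where E: "E = {w \<in> path_space H. w s \<in> A}" "s \<le> 0" "A \<in> sets borel"
      by (auto simp: evaluations_def)
    obtain n0 :: nat where n0: "- s < real n0" using reals_Archimedean2 by blast
    have "\<exists>E'\<in>sets P. \<forall>v\<in>space PB. \<forall>w\<in>space P. K n (v, w) \<in> E \<longleftrightarrow> w \<in> E'" if n: "n0 \<le> n" for n
    proof -
      define t where "t = real (Suc n)"
      \<comment> \<open>From here on, evaluating the glued path at \<open>s\<close> reads only an
        increment of \<open>w\<close>.\<close>
      have t: "0 \<le> t" "- t \<le> s" using n n0 by (auto simp: t_def)
      note [measurable] = evaluation_measurable
      have "(\<lambda>w. w (- s - t) - w (- t)) \<in> borel_measurable P" by measurable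
      then have "(\<lambda>w. w (- s - t) - w (- t)) -` A \<inter> space P \<in> sets P" using E(3) by (rule measurable_sets)
      moreover have "K n (v, w) \<in> E \<longleftrightarrow> w \<in> (\<lambda>w. w (- s - t) - w (- t)) -` A \<inter> space P"
        if "v \<in> space PB" "w \<in> space P" for v w
        using that E(2) t Bt_path_space[OF glue_Bt[of v w t]]
        unfolding K_def t_def[symmetric] by (auto simp: E(1) glue_def space_PB space_P)
      ultimately show ?thesis by blast
    qed
    moreover have "E \<in> sets P" unfolding sets_P_evaluations using ev by (rule sigma_sets.Basic)
    ultimately show "E \<in> \<E>" unfolding \<E>_def by blast
  qed
  have gen: "sets P = sigma_sets (space P) \<E>"
    unfolding space_P sets_P_evaluations
  proof
    show "sigma_sets (path_space H) (evaluations H) \<subseteq> sigma_sets (path_space H) \<E>"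
      using \<open>evaluations H \<subseteq> \<E>\<close> by (rule sigma_sets_mono')
    have "\<E> \<subseteq> sigma_sets (path_space H) (evaluations H)"
      unfolding sets_P_evaluations[symmetric] \<E>_def by blast
    then show "sigma_sets (path_space H) \<E> \<subseteq> sigma_sets (path_space H) (evaluations H)"
      by (rule sigma_sets_mono)
  qed
  show ?thesis
  \<comment> \<open>\<open>G\<close> and \<open>G'\<close> are the same set, once as an event of
    \<open>P\<close> and once of the restricted space \<open>PB\<close>.\<close>
  proof (rule mixing_zero_one[where K = K and G' = synchronized, OF prob_space_PB prob_space_P _ _ gen])
    show "K n \<in> PB \<Otimes>\<^sub>M P \<rightarrow>\<^sub>M P" "distr (PB \<Otimes>\<^sub>M P) P (K n) = P" for n
      unfolding K_def by (rule glue_measurable, simp, rule distr_glue, simp)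
    show "\<E> \<subseteq> sets P" by (auto simp: \<E>_def)
    show "Int_stable \<E>"
    proof (rule Int_stableI)
      fix A B assume AB: "A \<in> \<E>" "B \<in> \<E>"
      obtain m where m: "\<And>n. n \<ge> m \<Longrightarrow> \<exists>E'\<in>sets P. \<forall>v\<in>space PB. \<forall>w\<in>space P. K n (v, w) \<in> A \<longleftrightarrow> w \<in> E'"
        using AB(1) unfolding \<E>_def by blast
      obtain k where k: "\<And>n. n \<ge> k \<Longrightarrow> \<exists>E'\<in>sets P. \<forall>v\<in>space PB. \<forall>w\<in>space P. K n (v, w) \<in> B \<longleftrightarrow> w \<in> E'"
        using AB(2) unfolding \<E>_def by blast
      have "\<exists>E'\<in>sets P. \<forall>v\<in>space PB. \<forall>w\<in>space P. K n (v, w) \<in> A \<inter> B \<longleftrightarrow> w \<in> E'" if n: "max m k \<le> n" for n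
      proof -
        obtain A' where A': "A' \<in> sets P" "\<forall>v\<in>space PB. \<forall>w\<in>space P. K n (v, w) \<in> A \<longleftrightarrow> w \<in> A'"
          using m[of n] n by auto
        obtain B' where B': "B' \<in> sets P" "\<forall>v\<in>space PB. \<forall>w\<in>space P. K n (v, w) \<in> B \<longleftrightarrow> w \<in> B'"
          using k[of n] n by auto
        show ?thesis using A' B' by (intro bexI[of _ "A' \<inter> B'"]) auto
      qed
      moreover have "A \<inter> B \<in> sets P" using AB by (auto simp: \<E>_def)
      ultimately show "A \<inter> B \<in> \<E>" unfolding \<E>_def by blast
    qed
    show "\<exists>n0. \<forall>n\<ge>n0. \<exists>E'\<in>sets P. \<forall>v\<in>space PB. \<forall>w\<in>space P. K n (v, w) \<in> E \<longleftrightarrow> w \<in> E'" if "E \<in> \<E>" for E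
      using that by (auto simp: \<E>_def)
    show "synchronized \<in> sets P" "synchronized \<in> sets PB" "measure PB synchronized = measure P synchronized"
      using synchronized_sets sets_PB measure_PB by auto
    show "K n (v, w) \<in> synchronized" if "v \<in> synchronized" "w \<in> space P" for n v w
      using that unfolding K_def by (intro synchronized_glue) (auto simp: space_P)
  qed
qed

lemma synchronized_prob:
  assumes "measure (distr \<mu> borel fst) (cball 0 (R + C)) < C4 / (C3 + C4)"
  shows "measure P synchronized = 1"
proof -
  interpret P: prob_space P by (rule prob_space_P)
  have S: "synchronized \<in> sets P" using synchronized_sets sets_PB by blast
  have False if "measure P synchronized = 0"
  proof -
    have "synchronized \<in> null_sets P" using that S by (simp add: null_sets_def P.emeasure_eq_measure)
    then have "AE w in P. w \<notin> synchronized" by (rule AE_not_in)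
    then show False using ball_prob assms by fastforce
  qed
  then show ?thesis using synchronized_zero_one by blast
qed

lemma synchronization:
  assumes "measure P synchronized = 1"
  shows "(\<forall>\<eta>>0. measure P {w \<in> Bt. support_diameter p b w < \<eta>} = 1) \<and> weak_synchronization P Bt \<kappa>"
proof
  interpret P: prob_space P by (rule prob_space_P)
  have S: "synchronized \<in> sets P" using synchronized_sets sets_PB by blast
  show "\<forall>\<eta>>0. measure P {w \<in> Bt. support_diameter p b w < \<eta>} = 1"
  proof (intro allI impI)
    fix \<eta> :: real assume \<eta>: "0 < \<eta>"
    define T where "T = {w \<in> space PB. \<forall>i\<in>{1..p}. \<forall>j\<in>{1..p}. norm (b i w - b j w) < \<eta>}"
    have T_eq: "{w \<in> Bt. support_diameter p b w < \<eta>} = T"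
      unfolding T_def space_PB support_diameter_less_iff[OF p_pos \<eta>] ..
    have "T \<in> sets PB" unfolding T_def
    proof (intro sets.sets_Collect_finite_All')
      fix i j assume "i \<in> {1..p}" "j \<in> {1..p}"
      then have [measurable]: "b i \<in> borel_measurable PB" "b j \<in> borel_measurable PB"
        using b_measurable by auto
      show "{w \<in> space PB. norm (b i w - b j w) < \<eta>} \<in> sets PB" by measurable
    qed (use p_pos in auto)
    then have "T \<in> sets P" using sets_PB by blast
    moreover have "synchronized \<subseteq> T"
    proof
      fix w assume w: "w \<in> synchronized"
      have "norm (b i w - b j w) < \<eta>" if "i \<in> {1..p}" "j \<in> {1..p}" for i j
        using synchronizedD(2)[OF w that] \<eta> by simp
      then show "w \<in> T" using synchronizedD(1)[OF w] by (simp add: T_def space_PB)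
    qed
    ultimately have "1 \<le> measure P T" using assms P.finite_measure_mono[of synchronized T] by simp
    then show "measure P {w \<in> Bt. support_diameter p b w < \<eta>} = 1"
      unfolding T_eq using P.prob_le_1[of T] by linarith
  qed
  have "AE w in P. w \<in> synchronized" using P.AE_in_set_eq_1[OF S] assms by simp
  then have "AE w in P. w \<in> Bt \<longrightarrow> measure_support (\<kappa> w) = {b 1 w}"
    by (rule eventually_mono) (simp add: measure_support_\<kappa> points_synchronized)
  then show "weak_synchronization P Bt \<kappa>"
    unfolding weak_synchronization_def using b_measurable[of 1] p_pos by (intro bexI[of _ "b 1"]) (auto simp: PB_def)
qed

end

theorem theorem4p26:
  fixes H \<alpha> C1 C2 C3 C4 CF R C :: real
    and N p :: nat
    and P :: "('n::finite) path measure"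
    and DH :: "'n path \<Rightarrow> 'n path"
    and F :: "real ^ 'n \<Rightarrow> real ^ 'n"
    and \<sigma> :: "real ^ 'n ^ 'n"
    and \<Phi> :: "real \<Rightarrow> 'n path \<times> 'n path \<Rightarrow> real ^ 'n \<Rightarrow> real ^ 'n"
    and \<mu> :: "((real ^ 'n) \<times> 'n path) measure"
    and \<pi> :: "(real ^ 'n) measure"
    and Bt :: "'n path set"
    and \<kappa> :: "'n path \<Rightarrow> (real ^ 'n) measure"
    and b :: "nat \<Rightarrow> 'n path \<Rightarrow> real ^ 'n"
  assumes hurst: "0 < H" "H < 1"
    and noise: "wiener_measure H P" "fractional_operator H P \<alpha> DH"
    and standing: "standing_conditions H F \<sigma> C1 C2 C3 CF N"
    and flow: "\<forall>w \<in> path_space H \<times> path_space H. \<forall>x. sde_solution F \<sigma> DH w x (\<lambda>t. \<Phi> t w x)"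
    and invariant: "invariant_measure P \<Phi> \<mu>"
    and marginal: "\<pi> = distr \<mu> borel fst"
    and disint: "disintegration P \<Phi> \<mu> Bt \<kappa>"
    and monotone: "eventually_strictly_monotone F R C4"
    and finite_support: "finite_support_condition P Bt \<kappa> p b C"
    and small: "measure \<pi> (cball 0 (R + C)) < C4 / (C3 + C4)"
  shows "(\<forall>\<eta>>0. measure P {w \<in> Bt. support_diameter p b w < \<eta>} = 1) \<and>
         weak_synchronization P Bt \<kappa>"
proof -
  interpret finitely_supported_sde H \<alpha> C1 C2 C3 CF N P DH F \<sigma> \<Phi> \<mu> Bt \<kappa> C4 R C p b
    by unfold_locales (fact assms)+
  show ?thesis using small unfolding marginal by (intro synchronization synchronized_prob)
qed

end
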